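(* Let $d\geq 2$ be an integer. The numbers $N(C^d_h)$ of nonisomorphic leaf-induced subtrees of the complete $d$-ary trees $C^d_h$ satisfy $N(C^d_0)=1$ and, for every $h\geq 1$, $$N(C^d_h)=-N(C^d_{h-1})+\binom{d+N(C^d_{h-1})}{d}.$$ Furthermore, there is an effectively computable constant $\kappa(d)>1$ (depending only on $d$) such that $$N(C^d_h)=(1+o(1))\,(d!)^{\frac{1}{d-1}}\,\kappa(d)^{d^h}\qquad\text{as } h\to\infty.$$
   Context: A topological tree is a (finite) rooted tree with no vertex of outdegree $1$ (the one-vertex tree is a topological tree). Leaves are the vertices of outdegree $0$. Leaf-induced subtrees: let $T$ be a topological tree and $S$ a nonempty subset of its leaves. The subtree induced by $S$ is obtained as follows: (1) take the most recent common ancestor of the leaves in $S$ and all vertices and edges on the paths connecting it to the leaves in $S$, giving a tree rooted at that common ancestor; (2) contract every vertex of outdegree $1$ in this tree (if $g$ has outdegree $1$ and neighbours $f$ and $h$, delete $g$ and add the edge $\{f,h\}$). The result is again a topological tree; a single leaf induces the one-vertex tree. Isomorphism means isomorphism of rooted trees (root-preserving, children unordered). $N(T)$ denotes the number of isomorphism classes of leaf-induced subtrees of $T$, over all nonempty subsets $S$ of leaves. The complete $d$-ary tree $C^d_h$ of height $h$ is the rooted tree in which every vertex has outdegree $0$ or $d$ and all leaves are at distance $h$ from the root; it has $d^h$ leaves, and $C^d_0$ is the one-vertex tree. "Effectively computable" means that the real number $\kappa(d)$ can be approximated algorithmically to any prescribed precision. *)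

theory Defs
  imports "HOL-Analysis.Analysis" "HOL-Library.Landau_Symbols"
begin

section \<open>Rooted trees\<close>

text \<open>The arcs are directed away from the root: an arc \<open>(u, v)\<close> says that \<open>v\<close> is a child of \<open>u\<close>.\<close>

record 'v rtree =
  verts :: "'v set"
  root :: 'v
  arcs :: "('v \<times> 'v) set"

definition rooted_tree :: "'v rtree \<Rightarrow> bool" where
  "rooted_tree T \<longleftrightarrow>
     finite (verts T) \<and> root T \<in> verts T \<and> arcs T \<subseteq> verts T \<times> verts T \<and>
     (\<forall>u. (u, root T) \<notin> arcs T) \<and>
     (\<forall>v \<in> verts T - {root T}. \<exists>!u. (u, v) \<in> arcs T) \<and>
     (\<forall>v \<in> verts T. (root T, v) \<in> (arcs T)\<^sup>*)"

definition outdegree :: "'v rtree \<Rightarrow> 'v \<Rightarrow> nat" where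
  "outdegree T v = card {w. (v, w) \<in> arcs T}"

definition leaves :: "'v rtree \<Rightarrow> 'v set" where
  "leaves T = {v \<in> verts T. outdegree T v = 0}"

definition topological_tree :: "'v rtree \<Rightarrow> bool" where
  "topological_tree T \<longleftrightarrow> rooted_tree T \<and> (\<forall>v \<in> verts T. outdegree T v \<noteq> 1)"

definition rtree_iso :: "'v rtree \<Rightarrow> 'w rtree \<Rightarrow> bool" where
  "rtree_iso T T' \<longleftrightarrow>
     (\<exists>f. bij_betw f (verts T) (verts T') \<and> f (root T) = root T' \<and>
          (\<forall>u \<in> verts T. \<forall>v \<in> verts T. (u, v) \<in> arcs T \<longleftrightarrow> (f u, f v) \<in> arcs T'))"


section \<open>Leaf-induced subtrees\<close>

text \<open>Every vertex counts as an ancestor of itself.\<close>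

definition ancestor :: "'v rtree \<Rightarrow> 'v \<Rightarrow> 'v \<Rightarrow> bool" where
  "ancestor T u v \<longleftrightarrow> (u, v) \<in> (arcs T)\<^sup>*"

definition common_ancestor :: "'v rtree \<Rightarrow> 'v set \<Rightarrow> 'v \<Rightarrow> bool" where
  "common_ancestor T S a \<longleftrightarrow> a \<in> verts T \<and> (\<forall>s \<in> S. ancestor T a s)"

definition mrca :: "'v rtree \<Rightarrow> 'v set \<Rightarrow> 'v" where
  "mrca T S = (THE a. common_ancestor T S a \<and> (\<forall>b. common_ancestor T S b \<longrightarrow> ancestor T b a))"

text \<open>
  In a rooted tree, the vertices on the path from \<open>a\<close> down to \<open>s\<close> are those that are descendants of
  \<open>a\<close> and ancestors of \<open>s\<close>, and an arc \<open>(u, v)\<close> lies on that path iff \<open>u\<close> is a descendant of \<open>a\<close>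
  and \<open>v\<close> is an ancestor of \<open>s\<close>.
\<close>

definition spanned_subtree :: "'v rtree \<Rightarrow> 'v set \<Rightarrow> 'v rtree" where
  "spanned_subtree T S =
     \<lparr> verts = {v. ancestor T (mrca T S) v \<and> (\<exists>s \<in> S. ancestor T v s)},
       root = mrca T S,
       arcs = {(u, v) \<in> arcs T. ancestor T (mrca T S) u \<and> (\<exists>s \<in> S. ancestor T v s)} \<rparr>"

definition contract_vertex :: "'v \<Rightarrow> 'v rtree \<Rightarrow> 'v rtree" where
  "contract_vertex g T =
     \<lparr> verts = verts T - {g},
       root = root T,
       arcs = {(u, v) \<in> arcs T. u \<noteq> g \<and> v \<noteq> g} \<union> {(f, h). (f, g) \<in> arcs T \<and> (g, h) \<in> arcs T} \<rparr>"

text \<open>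
  \<open>contracts_to T T'\<close>: one reaches \<open>T'\<close> from \<open>T\<close> by contracting vertices of outdegree 1, one after
  the other, until none is left. In a spanned subtree the root (the most recent common ancestor) never
  has outdegree 1, so the restriction to \<open>g \<noteq> root T\<close> only ensures that \<open>g\<close> has a parent.
\<close>

inductive contracts_to :: "'v rtree \<Rightarrow> 'v rtree \<Rightarrow> bool" where
  finished: "\<forall>v \<in> verts T. outdegree T v \<noteq> 1 \<Longrightarrow> contracts_to T T"
| step: "g \<in> verts T \<Longrightarrow> g \<noteq> root T \<Longrightarrow> outdegree T g = 1 \<Longrightarrow>
         contracts_to (contract_vertex g T) T' \<Longrightarrow> contracts_to T T'"

definition leaf_induced_subtrees :: "'v rtree \<Rightarrow> 'v rtree set" where
  "leaf_induced_subtrees T =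
     {T'. \<exists>S. S \<noteq> {} \<and> S \<subseteq> leaves T \<and> contracts_to (spanned_subtree T S) T'}"

definition num_leaf_induced :: "'v rtree \<Rightarrow> nat" where
  "num_leaf_induced T =
     card (leaf_induced_subtrees T //
           {(A, B). A \<in> leaf_induced_subtrees T \<and> B \<in> leaf_induced_subtrees T \<and> rtree_iso A B})"


section \<open>Complete trees\<close>

definition is_complete_tree :: "nat \<Rightarrow> nat \<Rightarrow> 'v rtree \<Rightarrow> bool" where
  "is_complete_tree d h T \<longleftrightarrow>
     rooted_tree T \<and> (\<forall>v \<in> verts T. outdegree T v = 0 \<or> outdegree T v = d) \<and>
     (\<forall>v \<in> leaves T. (root T, v) \<in> arcs T ^^ h)"

text \<open>The vertices of the standard complete tree are words over \<open>{0, \<dots>, d - 1}\<close> of length at most \<open>h\<close>.\<close>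

definition complete_tree :: "nat \<Rightarrow> nat \<Rightarrow> nat list rtree" where
  "complete_tree d h =
     \<lparr> verts = {xs. set xs \<subseteq> {..<d} \<and> length xs \<le> h},
       root = [],
       arcs = {(xs, xs @ [i]) | xs i. set xs \<subseteq> {..<d} \<and> length xs < h \<and> i < d} \<rparr>"

lemma complete_tree_arc_iff:
  "(xs, ys) \<in> arcs (complete_tree d h) \<longleftrightarrow>
     (\<exists>i<d. ys = xs @ [i] \<and> set xs \<subseteq> {..<d} \<and> length xs < h)"
  by (auto simp: complete_tree_def)

lemma complete_tree_relpow:
  "set xs \<subseteq> {..<d} \<Longrightarrow> length xs \<le> h \<Longrightarrow> ([], xs) \<in> arcs (complete_tree d h) ^^ length xs"
proof (induction xs rule: rev_induct)
  case (snoc i xs)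
  then have "([], xs) \<in> arcs (complete_tree d h) ^^ length xs"
    and "(xs, xs @ [i]) \<in> arcs (complete_tree d h)"
    by (auto simp: complete_tree_arc_iff)
  then show ?case by auto
qed simp

lemma rooted_tree_complete_tree: "rooted_tree (complete_tree d h)"
proof -
  have "\<exists>!u. (u, v) \<in> arcs (complete_tree d h)"
    if "v \<in> verts (complete_tree d h) - {root (complete_tree d h)}" for v
  proof -
    from that have "v \<noteq> []" by (auto simp: complete_tree_def)
    then obtain xs i where "v = xs @ [i]" by (metis rev_exhaust)
    with that show ?thesis by (auto simp: complete_tree_arc_iff complete_tree_def)
  qed
  moreover have "([], v) \<in> (arcs (complete_tree d h))\<^sup>*"
    if "v \<in> verts (complete_tree d h)" for v
    using complete_tree_relpow[of v d h] that
    by (auto simp: complete_tree_def intro: relpow_imp_rtrancl)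
  ultimately show ?thesis
    by (auto simp: rooted_tree_def complete_tree_def finite_lists_length_le)
qed

lemma outdegree_complete_tree:
  assumes "xs \<in> verts (complete_tree d h)"
  shows "outdegree (complete_tree d h) xs = (if length xs < h then d else 0)"
proof -
  have "{ys. (xs, ys) \<in> arcs (complete_tree d h)} =
        (if length xs < h then (\<lambda>i. xs @ [i]) ` {..<d} else {})"
    using assms by (auto simp: complete_tree_arc_iff) (auto simp: complete_tree_def)
  then show ?thesis
    by (auto simp: outdegree_def card_image inj_on_def)
qed

lemma is_complete_tree_complete_tree:
  assumes "d \<ge> 1"
  shows "is_complete_tree d h (complete_tree d h)"
proof -
  have "(root (complete_tree d h), v) \<in> arcs (complete_tree d h) ^^ h"
    if "v \<in> leaves (complete_tree d h)" for v
  proof -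
    from that have v: "v \<in> verts (complete_tree d h)" "outdegree (complete_tree d h) v = 0"
      by (auto simp: leaves_def)
    with outdegree_complete_tree[OF v(1)] assms have "length v = h"
      by (auto simp: complete_tree_def split: if_splits)
    with v(1) complete_tree_relpow[of v d h] show ?thesis
      by (auto simp: complete_tree_def)
  qed
  then show ?thesis
    by (auto simp: is_complete_tree_def rooted_tree_complete_tree outdegree_complete_tree)
qed

lemma topological_tree_complete_tree:
  "d \<ge> 2 \<Longrightarrow> topological_tree (complete_tree d h)"
  by (auto simp: topological_tree_def rooted_tree_complete_tree outdegree_complete_tree)


section \<open>Computable real numbers\<close>

text \<open>
  \<open>recursive_fun k f\<close>: \<open>f\<close> is a total recursive function of \<open>k\<close> arguments (only its values on lists
  of length \<open>k\<close> matter). This is the usual closure under composition, primitive recursion and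
  minimization of regular functions; by Kleene's normal form theorem, minimization of regular functions
  suffices to obtain all total computable functions.
\<close>

inductive recursive_fun :: "nat \<Rightarrow> (nat list \<Rightarrow> nat) \<Rightarrow> bool" where
  zero: "recursive_fun k (\<lambda>xs. 0)"
| succ: "recursive_fun 1 (\<lambda>xs. Suc (xs ! 0))"
| proj: "i < k \<Longrightarrow> recursive_fun k (\<lambda>xs. xs ! i)"
| comp: "recursive_fun (length gs) f \<Longrightarrow> (\<And>g. g \<in> set gs \<Longrightarrow> recursive_fun k g) \<Longrightarrow>
         recursive_fun k (\<lambda>xs. f (map (\<lambda>g. g xs) gs))"
| prim_rec: "recursive_fun k f \<Longrightarrow> recursive_fun (Suc (Suc k)) g \<Longrightarrow>
         recursive_fun (Suc k) (\<lambda>xs. rec_nat (f (tl xs)) (\<lambda>n y. g (n # y # tl xs)) (hd xs))"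
| minimize: "recursive_fun (Suc k) f \<Longrightarrow> (\<And>xs. length xs = k \<Longrightarrow> \<exists>n. f (n # xs) = 0) \<Longrightarrow>
         recursive_fun k (\<lambda>xs. LEAST n. f (n # xs) = 0)"

definition computable_fun :: "(nat \<Rightarrow> nat) \<Rightarrow> bool" where
  "computable_fun f \<longleftrightarrow> (\<exists>g. recursive_fun 1 g \<and> (\<forall>n. f n = g [n]))"

text \<open>
  A real number is computable if some algorithm outputs, on input \<open>n\<close>, a rational number (given as
  \<open>(p - q) / r\<close> with natural numbers \<open>p, q, r\<close>) within \<open>1/2\<^sup>n\<close> of it.
\<close>

definition computable_real :: "real \<Rightarrow> bool" where
  "computable_real x \<longleftrightarrow>
     (\<exists>p q r. computable_fun p \<and> computable_fun q \<and> computable_fun r \<and>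
        (\<forall>n. r n > 0 \<and> \<bar>x - (real (p n) - real (q n)) / real (r n)\<bar> \<le> 1 / 2 ^ n))"

end

theory Submission
  imports Defs "HOL-Library.Sublist"
begin

text \<open>
  Assign to every rooted tree its shape, the nested multiset of the shapes of the branches, where a
  vertex with a single child is given the shape of that child. Contractions preserve the shape, and
  two topological trees are isomorphic iff their shapes agree, so \<open>num_leaf_induced\<close> counts the
  shapes of the induced subtrees. In height \<open>h + 1\<close> these are the leaf and the multisets of
  \<open>2, \<dots>, d\<close> shapes occurring in height \<open>h\<close>, which gives the recurrence.

  Writing \<open>c = (d!) powr (1 / (d - 1))\<close>, the logarithms \<open>x h = ln (N h / c)\<close> satisfy
  \<open>x (h + 1) = d * x h + e h\<close> with \<open>e h \<longlonglongrightarrow> 0\<close>, hence \<open>x h - d ^ h * l \<longlonglongrightarrow> 0\<close> for some \<open>l\<close>, and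
  \<open>\<kappa> = exp l\<close>. As \<open>N h / \<kappa> ^ (d ^ h)\<close> stays within constant bounds, the \<open>d ^ h\<close>-th root of \<open>N h\<close>
  approximates \<open>\<kappa>\<close> with an error \<open>O(1 / d ^ h)\<close>.
\<close>

section \<open>Shapes of rooted trees\<close>

datatype shape = Node "shape multiset"

text \<open>A vertex with exactly one child is transparent: it gets the shape of that child, so that the
  shape is invariant under \<open>contract_vertex\<close>.\<close>

definition join :: "shape multiset \<Rightarrow> shape" where
  "join M = (if size M = 1 then (THE t. M = {#t#}) else Node M)"

lemma join_single [simp]: "join {#t#} = t"
  by (simp add: join_def)

lemma join_eq_Node: "size M \<noteq> 1 \<Longrightarrow> join M = Node M"
  by (simp add: join_def)

text \<open>A relation on arcs rather than a recursive function: its derivations supply the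
  induction over the tree. The function \<open>f\<close> holds chosen shapes of the children, its
  other values are arbitrary.\<close>

inductive has_shape :: "('v \<times> 'v) set \<Rightarrow> 'v \<Rightarrow> shape \<Rightarrow> bool" for R where
  has_shapeI: "(\<And>w. (v, w) \<in> R \<Longrightarrow> has_shape R w (f w)) \<Longrightarrow>
     has_shape R v (join (image_mset f (mset_set (R `` {v}))))"

lemma has_shape_Image:
  assumes "\<And>w. w \<in> A \<Longrightarrow> has_shape R w (f w)" "R `` {v} = A"
    "image_mset f (mset_set A) = M"
  shows "has_shape R v (join M)"
proof -
  have "has_shape R v (join (image_mset f (mset_set (R `` {v}))))"
    by (rule has_shapeI) (use assms in auto)
  then show ?thesis using assms by simp
qed

lemma has_shape_unique: "has_shape R v s \<Longrightarrow> has_shape R v t \<Longrightarrow> s = t"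
proof (induction arbitrary: t rule: has_shape.induct)
  case (has_shapeI v f)
  from has_shapeI.prems obtain g where
    g: "\<And>w. (v, w) \<in> R \<Longrightarrow> has_shape R w (g w)"
    and t: "t = join (image_mset g (mset_set (R `` {v})))"
    by (auto elim: has_shape.cases)
  have "image_mset f (mset_set (R `` {v})) = image_mset g (mset_set (R `` {v}))"
    by (cases "finite (R `` {v})") (auto intro!: image_mset_cong has_shapeI.IH g)
  then show ?case by (simp add: t)
qed

section \<open>Isomorphism and equality of shapes\<close>

lemma outdegree_eq_card: "outdegree T v = card (arcs T `` {v})"
  by (simp add: outdegree_def Image_def)

lemma rooted_treeD:
  assumes "rooted_tree T"
  shows "finite (verts T)" "root T \<in> verts T" "(u, root T) \<notin> arcs T"
    "(u, v) \<in> arcs T \<Longrightarrow> u \<in> verts T" "(u, v) \<in> arcs T \<Longrightarrow> v \<in> verts T"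
    "(u, w) \<in> arcs T \<Longrightarrow> (v, w) \<in> arcs T \<Longrightarrow> u = v"
    "w \<in> verts T \<Longrightarrow> w \<noteq> root T \<Longrightarrow> \<exists>u. (u, w) \<in> arcs T"
    "v \<in> verts T \<Longrightarrow> (root T, v) \<in> (arcs T)\<^sup>*"
proof -
  note T = assms[unfolded rooted_tree_def]
  show "(u, w) \<in> arcs T \<Longrightarrow> (v, w) \<in> arcs T \<Longrightarrow> u = v"
  proof -
    assume uv: "(u, w) \<in> arcs T" "(v, w) \<in> arcs T"
    with T have "w \<in> verts T - {root T}" by auto
    with T uv show "u = v" by blast
  qed
qed (use assms[unfolded rooted_tree_def] in blast)+

lemma rooted_tree_finite_children: "rooted_tree T \<Longrightarrow> finite (arcs T `` {v})"
  by (rule finite_subset[of _ "verts T"]) (auto dest: rooted_treeD)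

text \<open>An isomorphism maps the children of \<open>v\<close> bijectively onto those of its
  image, so a derivation of the shape is transported vertex by vertex.\<close>

lemma rtree_iso_imp_same_shape:
  assumes "rooted_tree A" "rooted_tree B" "rtree_iso A B" "has_shape (arcs A) (root A) t"
  shows "has_shape (arcs B) (root B) t"
proof -
  from assms(3) obtain f where f: "bij_betw f (verts A) (verts B)" "f (root A) = root B"
    and arcs: "\<And>u v. u \<in> verts A \<Longrightarrow> v \<in> verts A \<Longrightarrow> (u, v) \<in> arcs A \<longleftrightarrow> (f u, f v) \<in> arcs B"
    unfolding rtree_iso_def by blast
  have "has_shape (arcs B) (f v) t" if "has_shape (arcs A) v t" "v \<in> verts A" for v t
    using that
  proof (induction rule: has_shape.induct)
    case (has_shapeI v s)
    have sub: "arcs A `` {v} \<subseteq> verts A" using rooted_treeD[OF assms(1)] by auto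
    have img: "arcs B `` {f v} = f ` (arcs A `` {v})"
    proof (intro equalityI subsetI)
      fix w assume "w \<in> arcs B `` {f v}"
      then have "(f v, w) \<in> arcs B" "w \<in> verts B" using rooted_treeD[OF assms(2)] by auto
      moreover from this f(1) obtain x where "x \<in> verts A" "w = f x" by (auto simp: bij_betw_def)
      ultimately show "w \<in> f ` (arcs A `` {v})" using arcs has_shapeI.prems by simp
    qed (use sub arcs has_shapeI.prems in auto)
    have inj: "inj_on f (arcs A `` {v})"
      using f(1) sub by (auto simp: bij_betw_def intro: inj_on_subset)
    let ?g = "\<lambda>w. s (the_inv_into (verts A) f w)"
    have inv: "the_inv_into (verts A) f (f w) = w" if "w \<in> verts A" for w
      using f(1) that by (simp add: bij_betw_def the_inv_into_f_f)
    show ?case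
    proof (rule has_shape_Image[OF _ img])
      show "has_shape (arcs B) w (?g w)" if "w \<in> f ` (arcs A `` {v})" for w
        using that has_shapeI.IH inv sub by auto
      have "image_mset ?g (mset_set (f ` (arcs A `` {v}))) = image_mset (\<lambda>w. ?g (f w)) (mset_set (arcs A `` {v}))"
        using inj by (simp flip: image_mset_mset_set add: multiset.map_comp comp_def)
      also have "\<dots> = image_mset s (mset_set (arcs A `` {v}))"
        using rooted_tree_finite_children[OF assms(1)] inv sub by (intro image_mset_cong) auto
      finally show "image_mset ?g (mset_set (f ` (arcs A `` {v}))) = image_mset s (mset_set (arcs A `` {v}))" .
    qed
  qed
  from this[OF assms(4)] f(2) rooted_treeD(2)[OF assms(1)] show ?thesis by simp
qed

text \<open>The elements of \<open>A\<close> are matched one at a time with equally labelled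
  elements of \<open>B\<close>. With shapes as labels this pairs off the children of two vertices of
  the same shape.\<close>

lemma image_mset_eq_imp_bij:
  assumes "finite A" "finite B" "image_mset f (mset_set A) = image_mset g (mset_set B)"
  shows "\<exists>\<sigma>. bij_betw \<sigma> A B \<and> (\<forall>a\<in>A. g (\<sigma> a) = f a)"
  using assms
proof (induction A arbitrary: B rule: finite_induct)
  case empty
  then show ?case by (auto simp: mset_set_empty_iff bij_betw_def)
next
  case (insert a A)
  then have "f a \<in># image_mset g (mset_set B)" by (metis image_mset_add_mset mset_set.insert union_single_eq_member)
  then obtain b where b: "b \<in> B" "g b = f a" using insert.prems(1) by auto
  then have "image_mset g (mset_set B) = add_mset (f a) (image_mset g (mset_set (B - {b})))"
    using insert.prems(1) by (simp add: mset_set.remove)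
  with insert have "image_mset f (mset_set A) = image_mset g (mset_set (B - {b}))" by simp
  from insert.IH[OF _ this] insert.prems(1) obtain \<sigma>
    where \<sigma>: "bij_betw \<sigma> A (B - {b})" "\<forall>a\<in>A. g (\<sigma> a) = f a" by auto
  have "bij_betw (\<sigma>(a := b)) (insert a A) (insert b (B - {b}))"
    using \<sigma>(1) insert.hyps by (auto simp: bij_betw_def inj_on_def)
  then show ?case
    using \<sigma>(2) b insert.hyps by (intro exI[of _ "\<sigma>(a := b)"]) (auto simp: insert_absorb simp del: fun_upd_apply, auto)
qed

text \<open>The isomorphism is the relation \<open>P\<close> generated downwards from the pair of roots by bijections
  between the children that respect shapes; unique parents make \<open>P\<close> functional in both directions.\<close>

lemma same_shape_imp_rtree_iso:
  assumes A: "topological_tree A" and B: "topological_tree B"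
    and "has_shape (arcs A) (root A) t" "has_shape (arcs B) (root B) t"
  shows "rtree_iso A B"
proof -
  let ?R = "arcs A" and ?S = "arcs B"
  note rA = A[unfolded topological_tree_def, THEN conjunct1]
    and rB = B[unfolded topological_tree_def, THEN conjunct1]
  note tA = rooted_treeD[OF rA] and tB = rooted_treeD[OF rB]
  define same where "same v w \<longleftrightarrow> v \<in> verts A \<and> w \<in> verts B \<and>
    (\<exists>t. has_shape ?R v t \<and> has_shape ?S w t)" for v w
  have "\<exists>\<sigma>. bij_betw \<sigma> (?R `` {v}) (?S `` {w}) \<and> (\<forall>x\<in>?R `` {v}. same x (\<sigma> x))"
    if "same v w" for v w
  proof -
    from that obtain f g where vw: "v \<in> verts A" "w \<in> verts B"
      and f: "\<And>x. (v, x) \<in> ?R \<Longrightarrow> has_shape ?R x (f x)"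
      and g: "\<And>x. (w, x) \<in> ?S \<Longrightarrow> has_shape ?S x (g x)"
      and eq: "join (image_mset f (mset_set (?R `` {v}))) = join (image_mset g (mset_set (?S `` {w})))"
      unfolding same_def by (metis has_shape.cases)
    \<comment> \<open>In a topological tree no vertex has a single child, so \<open>join\<close> is
      \<open>Node\<close> at both vertices, and injectivity of \<open>Node\<close> yields equal
      multisets.\<close>
    have "card (?R `` {v}) \<noteq> 1" "card (?S `` {w}) \<noteq> 1"
      using A B vw unfolding topological_tree_def outdegree_eq_card by auto
    then have "image_mset f (mset_set (?R `` {v})) = image_mset g (mset_set (?S `` {w}))"
      using eq by (simp add: join_eq_Node)
    from image_mset_eq_imp_bij[OF rooted_tree_finite_children[OF rA] rooted_tree_finite_children[OF rB] this]
    obtain \<sigma> where \<sigma>: "bij_betw \<sigma> (?R `` {v}) (?S `` {w})" "\<forall>x\<in>?R `` {v}. g (\<sigma> x) = f x" by blast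
    have "same x (\<sigma> x)" if "x \<in> ?R `` {v}" for x
    proof -
      have "\<sigma> x \<in> ?S `` {w}" using \<sigma>(1) that by (auto simp: bij_betw_def)
      with that \<sigma>(2) f[of x] g[of "\<sigma> x"] show ?thesis
        unfolding same_def using tA(5) tB(5) by auto
    qed
    with \<sigma>(1) show ?thesis by blast
  qed
  then obtain \<sigma> where \<sigma>: "\<And>v w. same v w \<Longrightarrow> bij_betw (\<sigma> v w) (?R `` {v}) (?S `` {w})"
    and same_\<sigma>: "\<And>v w x. same v w \<Longrightarrow> (v, x) \<in> ?R \<Longrightarrow> same x (\<sigma> v w x)"
    by (metis Image_singleton_iff)
  define P where "P = {((v, w), (x, \<sigma> v w x)) | v w x. (v, x) \<in> ?R \<and> same v w}\<^sup>* `` {(root A, root B)}"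
  have P_root: "(root A, root B) \<in> P" by (simp add: P_def)
  have same_root: "same (root A) (root B)"
    using assms(3,4) tA(2) tB(2) by (auto simp: same_def)
  have P_step: "(x, \<sigma> v w x) \<in> P" if "(v, w) \<in> P" "same v w" "(v, x) \<in> ?R" for v w x
    using that unfolding P_def by (auto intro: rtrancl_into_rtrancl)
  have P_cases: "x = root A \<and> y = root B \<or>
      (\<exists>v w. (v, w) \<in> P \<and> same v w \<and> (v, x) \<in> ?R \<and> y = \<sigma> v w x)" if "(x, y) \<in> P" for x y
    using that unfolding P_def by (auto elim: rtranclE)
  have P_same: "same x y" if "(x, y) \<in> P" for x y
    using P_cases[OF that] same_root same_\<sigma> by auto
  have \<sigma>_arc: "(w, \<sigma> v w x) \<in> ?S" if "(v, w) \<in> P" "(v, x) \<in> ?R" for v w x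
    using \<sigma>[OF P_same[OF that(1)]] that(2) by (auto simp: bij_betw_def)
  have P_arc: "\<exists>v w. (v, w) \<in> P \<and> (v, x) \<in> ?R \<and> (w, y) \<in> ?S \<and> y = \<sigma> v w x"
    if "(x, y) \<in> P" "x \<noteq> root A \<or> y \<noteq> root B" for x y
    using P_cases[OF that(1)] that(2) \<sigma>_arc by blast
  have fun_P: "y = y'" if "(x, y) \<in> P" "(x, y') \<in> P" for x y y'
  proof -
    have "(root A, x) \<in> ?R\<^sup>*" using P_same[OF that(1)] tA(8) by (simp add: same_def)
    then show ?thesis using that
    proof (induction arbitrary: y y' rule: rtrancl_induct)
      case base
      then show ?case using P_arc tA(3) by metis
    next
      case (step v x)
      then have "x \<noteq> root A" using tA(3) by auto
      with step show ?case using P_arc[of x y] P_arc[of x y'] tA(6) by metis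
    qed
  qed
  have inj_P: "x = x'" if "(x, y) \<in> P" "(x', y) \<in> P" for x x' y
  proof -
    have "(root B, y) \<in> ?S\<^sup>*" using P_same[OF that(1)] tB(8) by (simp add: same_def)
    then show ?thesis using that
    proof (induction arbitrary: x x' rule: rtrancl_induct)
      case base
      then show ?case using P_arc tB(3) by metis
    next
      case (step w y)
      then have "y \<noteq> root B" using tB(3) by auto
      \<comment> \<open>Both parents lie over the same \<open>w\<close>, so \<open>v = v'\<close> by
        induction, and injectivity of \<open>\<sigma> v w\<close> on the children of
        \<open>v\<close> gives \<open>x = x'\<close>.\<close>
      with step.prems obtain v v' where v: "(v, w) \<in> P" "(v, x) \<in> ?R" "y = \<sigma> v w x"
        and v': "(v', w) \<in> P" "(v', x') \<in> ?R" "y = \<sigma> v' w x'"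
        using P_arc[of x y] P_arc[of x' y] tB(6)[OF step.hyps(2)] by metis
      from step.IH[OF v(1) v'(1)] have "v = v'" .
      with v v' \<sigma>[OF P_same[OF v(1)]] show ?case by (auto simp: bij_betw_def inj_on_def)
    qed
  qed
  have total_P: "\<exists>y. (x, y) \<in> P" if "x \<in> verts A" for x
    using tA(8)[OF that]
    by (induction rule: rtrancl_induct) (use P_root P_step P_same in blast)+
  have onto_P: "\<exists>x. (x, y) \<in> P" if "y \<in> verts B" for y
    using tB(8)[OF that]
  proof (induction rule: rtrancl_induct)
    case (step w y)
    then obtain v where v: "(v, w) \<in> P" by blast
    with \<sigma>[OF P_same[OF v]] step.hyps(2) obtain x where "(v, x) \<in> ?R" "y = \<sigma> v w x"
      by (auto simp: bij_betw_def)
    with P_step[OF v P_same[OF v]] show ?case by blast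
  qed (use P_root in blast)
  define f where "f x = (THE y. (x, y) \<in> P)" for x
  have f: "f x = y" if "(x, y) \<in> P" for x y
    unfolding f_def using that fun_P by blast
  have fP: "(x, f x) \<in> P" if "x \<in> verts A" for x
    using total_P[OF that] f by auto
  show ?thesis
    unfolding rtree_iso_def
  proof (intro exI conjI ballI)
    show "bij_betw f (verts A) (verts B)"
      unfolding bij_betw_def
    proof
      show "inj_on f (verts A)" using fP inj_P by (metis inj_onI)
      show "f ` verts A = verts B" using fP P_same onto_P f by (force simp: same_def)
    qed
    show "f (root A) = root B" using f P_root by simp
    fix u v assume uv: "u \<in> verts A" "v \<in> verts A"
    show "(u, v) \<in> ?R \<longleftrightarrow> (f u, f v) \<in> ?S"
    proof
      assume "(u, v) \<in> ?R"
      with f[OF P_step[OF fP[OF uv(1)] P_same[OF fP[OF uv(1)]]]] \<sigma>_arc[OF fP[OF uv(1)]]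
      show "(f u, f v) \<in> ?S" by auto
    next
      \<comment> \<open>The child \<open>x\<close> of \<open>u\<close> that is paired with
        \<open>f v\<close> must be \<open>v\<close> itself, because \<open>P\<close> is
        injective.\<close>
      assume "(f u, f v) \<in> ?S"
      then obtain x where x: "(u, x) \<in> ?R" "f v = \<sigma> u (f u) x"
        using \<sigma>[OF P_same[OF fP[OF uv(1)]]] by (auto simp: bij_betw_def)
      with P_step[OF fP[OF uv(1)] P_same[OF fP[OF uv(1)]], of x] fP[OF uv(2)] inj_P
      show "(u, v) \<in> ?R" by metis
    qed
  qed
qed

section \<open>Contracting a vertex of outdegree 1\<close>

lemma arcs_contract_vertex_iff:
  "(u, v) \<in> arcs (contract_vertex g T) \<longleftrightarrow>
     (u, v) \<in> arcs T \<and> u \<noteq> g \<and> v \<noteq> g \<or> (u, g) \<in> arcs T \<and> (g, v) \<in> arcs T"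
  by (auto simp: contract_vertex_def)

lemma verts_contract_vertex [simp]: "verts (contract_vertex g T) = verts T - {g}"
  and root_contract_vertex [simp]: "root (contract_vertex g T) = root T"
  by (auto simp: contract_vertex_def)

locale contraction =
  fixes T :: "'v rtree" and g h p :: 'v
  assumes T: "rooted_tree T" and parent: "(p, g) \<in> arcs T" and child: "arcs T `` {g} = {h}"
begin

text \<open>A cycle through \<open>v\<close> enters \<open>v\<close> from its unique parent, hence
  also passes through that parent. Moving up in this way ends at the root, which no arc
  enters.\<close>

lemma acyclic: "(v, v) \<notin> (arcs T)\<^sup>+"
proof -
  have "(v, v) \<notin> (arcs T)\<^sup>+" if "(root T, v) \<in> (arcs T)\<^sup>*" for v
    using that
  proof (induction rule: rtrancl_induct)
    case base
    then show ?case using rooted_treeD(3)[OF T] by (meson tranclE)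
  next
    case (step u v)
    show ?case
    proof
      assume "(v, v) \<in> (arcs T)\<^sup>+"
      then obtain w where "(v, w) \<in> (arcs T)\<^sup>*" "(w, v) \<in> arcs T" by (meson tranclD2)
      with step.hyps(2) rooted_treeD(6)[OF T] have "(v, u) \<in> (arcs T)\<^sup>*" by metis
      with step.hyps(2) have "(u, u) \<in> (arcs T)\<^sup>+" by (rule rtrancl_into_trancl2)
      with step.IH show False by simp
    qed
  qed
  moreover have "v \<in> verts T" if "(v, v) \<in> (arcs T)\<^sup>+"
    using that rooted_treeD(4)[OF T] by (meson tranclD)
  ultimately show ?thesis using rooted_treeD(8)[OF T] by blast
qed

text \<open>The last fact shows that \<open>h\<close> is a new child of \<open>p\<close> after the
  contraction, so no child is counted twice.\<close>

lemma distinct: "p \<noteq> g" "h \<noteq> g" "h \<noteq> p" "(p, h) \<notin> arcs T"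
proof -
  have gh: "(g, h) \<in> arcs T" using child by auto
  show "p \<noteq> g" using acyclic[of g] parent by auto
  show "h \<noteq> g" using acyclic[of g] gh by auto
  show "h \<noteq> p" using acyclic[of g] gh parent by (meson trancl.simps)
  show "(p, h) \<notin> arcs T" using gh \<open>p \<noteq> g\<close> rooted_treeD(6)[OF T] by blast
qed

lemma arc_child_iff: "(g, w) \<in> arcs T \<longleftrightarrow> w = h"
  using child by auto

lemma arc_parent_iff: "(v, g) \<in> arcs T \<longleftrightarrow> v = p"
  using parent rooted_treeD(6)[OF T] by blast

lemma arc_iff:
  "(u, v) \<in> arcs (contract_vertex g T) \<longleftrightarrow> (u, v) \<in> arcs T \<and> u \<noteq> g \<and> v \<noteq> g \<or> u = p \<and> v = h"
  by (simp add: arcs_contract_vertex_iff arc_child_iff arc_parent_iff)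

lemma children:
  "v \<noteq> g \<Longrightarrow> v \<noteq> p \<Longrightarrow> arcs (contract_vertex g T) `` {v} = arcs T `` {v}"
  "arcs (contract_vertex g T) `` {p} = insert h (arcs T `` {p} - {g})"
  unfolding set_eq_iff Image_singleton_iff arc_iff insert_iff Diff_iff
  using arc_parent_iff distinct(1) by blast+

lemma rooted_tree_contract_vertex: "rooted_tree (contract_vertex g T)"
proof -
  let ?C = "arcs (contract_vertex g T)"
  note gh = arc_child_iff and pg = arc_parent_iff and C = arc_iff
  have "\<exists>!u. (u, v) \<in> ?C" if v: "v \<in> verts T" "v \<noteq> g" "v \<noteq> root T" for v
  proof (cases "v = h")
    case True
    have "u = g" if "(u, h) \<in> arcs T" for u using that gh[of h] rooted_treeD(6)[OF T] by blast
    then show ?thesis using True by (auto simp: C)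
  next
    case False
    from rooted_treeD(7)[OF T v(1,3)] obtain u where u: "(u, v) \<in> arcs T" by blast
    then have "u \<noteq> g" using False gh by auto
    show ?thesis
    proof (rule ex1I[of _ u])
      show "(u, v) \<in> ?C" using u v \<open>u \<noteq> g\<close> by (simp add: C)
      show "u' = u" if "(u', v) \<in> ?C" for u'
        using that u False rooted_treeD(6)[OF T] unfolding C by blast
    qed
  qed
  \<comment> \<open>Induction along the old path from the root; at \<open>g\<close>, which
    disappears, the claim is about its parent \<open>p\<close> instead.\<close>
  moreover have "(if v = g then (root T, p) \<in> ?C\<^sup>* else (root T, v) \<in> ?C\<^sup>*)" if "v \<in> verts T" for v
    using rooted_treeD(8)[OF T that]
  proof (induction rule: rtrancl_induct)
    case base
    have "root T \<noteq> g" using parent rooted_treeD(3)[OF T] by metis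
    then show ?case by simp
  next
    case (step u v)
    show ?case
    proof (cases "u = g")
      case True
      with step.hyps(2) have "v = h" using gh by simp
      moreover have "(p, h) \<in> ?C" by (simp add: C)
      ultimately show ?thesis using step.IH True distinct by auto
    next
      case False
      show ?thesis
      proof (cases "v = g")
        case True
        with step False pg show ?thesis by simp
      next
        case v: False
        with False step.hyps(2) have "(u, v) \<in> ?C" by (simp add: C)
        with step.IH False v show ?thesis by auto
      qed
    qed
  qed
  moreover have "(u, root T) \<notin> ?C" for u
    using rooted_treeD(3)[OF T] gh by (metis C)
  moreover have "root T \<noteq> g" using parent rooted_treeD(3)[OF T] by metis
  moreover have "u \<in> verts T - {g} \<and> v \<in> verts T - {g}" if "(u, v) \<in> ?C" for u v
    using that rooted_treeD(4,5)[OF T] parent gh[of h] distinct unfolding C by auto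
  then have "?C \<subseteq> (verts T - {g}) \<times> (verts T - {g})" by auto
  ultimately show ?thesis
    unfolding rooted_tree_def using rooted_treeD(1,2)[OF T] by auto
qed

text \<open>Among the remaining vertices only \<open>p\<close> gets different children, and there
  \<open>h\<close> replaces \<open>g\<close>.\<close>

lemma outdegree_contract_vertex:
  assumes "v \<noteq> g"
  shows "outdegree (contract_vertex g T) v = outdegree T v"
proof (cases "v = p")
  case True
  have "outdegree T p = Suc (card (arcs T `` {p} - {g}))"
    unfolding outdegree_eq_card
    using parent rooted_tree_finite_children[OF T] by (subst card.remove[of _ g]) auto
  then show ?thesis
    using True distinct rooted_tree_finite_children[OF T] by (simp add: outdegree_eq_card children)
qed (use assms in \<open>simp add: outdegree_eq_card children\<close>)

text \<open>The vertex \<open>g\<close> passes on the shape of its only child \<open>h\<close>, so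
  replacing \<open>g\<close> by \<open>h\<close> below \<open>p\<close> keeps the multiset of
  shapes. For \<open>v = g\<close> the claim is about \<open>h\<close>, so that the induction also
  covers the removed vertex.\<close>

lemma has_shape_contract_vertex:
  assumes "has_shape (arcs T) v t"
  shows "has_shape (arcs (contract_vertex g T)) (if v = g then h else v) t"
  using assms
proof (induction rule: has_shape.induct)
  case (has_shapeI v f)
  let ?C = "arcs (contract_vertex g T)"
  show ?case
  proof (cases "v = g")
    case True
    have "has_shape ?C h (f h)" using has_shapeI.IH[of h] child True distinct by auto
    then show ?thesis using True child by simp
  next
    case False
    have fin: "finite (arcs T `` {p})" by (rule rooted_tree_finite_children[OF T])
    have "has_shape ?C v (join (image_mset f (mset_set (arcs T `` {v}))))"
    proof (cases "v = p")
      case True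
      have "mset_set (arcs T `` {p}) = add_mset g (mset_set (arcs T `` {p} - {g}))"
        using parent fin by (intro mset_set.remove) auto
      moreover have "mset_set (insert h (arcs T `` {p} - {g})) = add_mset h (mset_set (arcs T `` {p} - {g}))"
        using fin distinct by (intro mset_set.insert) auto
      \<comment> \<open>Overwriting \<open>f\<close> at \<open>h\<close> affects no other child of
        \<open>p\<close>, because \<open>h\<close> was not among the old children.\<close>
      moreover have "image_mset (f(h := f g)) (mset_set (arcs T `` {p} - {g})) = image_mset f (mset_set (arcs T `` {p} - {g}))"
        using fin distinct by (intro image_mset_cong) auto
      ultimately have eq: "image_mset (f(h := f g)) (mset_set (insert h (arcs T `` {p} - {g})))
          = image_mset f (mset_set (arcs T `` {p}))"
        by simp
      show ?thesis
        unfolding True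
      proof (rule has_shape_Image[OF _ children(2) eq])
        fix w assume w: "w \<in> insert h (arcs T `` {p} - {g})"
        show "has_shape ?C w ((f(h := f g)) w)"
        proof (cases "w = h")
          case True
          then show ?thesis using has_shapeI.IH[of g] parent \<open>v = p\<close> by simp
        next
          case False
          then show ?thesis using has_shapeI.IH[of w] w \<open>v = p\<close> by auto
        qed
      qed
    next
      case v: False
      have "(v, w) \<in> arcs T \<Longrightarrow> w \<noteq> g" for w using v parent rooted_treeD(6)[OF T] by blast
      then show ?thesis
        using has_shapeI.IH by (intro has_shape_Image[OF _ children(1)[OF False v] refl]) fastforce
    qed
    with False show ?thesis by simp
  qed
qed

end

lemma contractionE:
  assumes "rooted_tree T" "g \<in> verts T" "g \<noteq> root T" "outdegree T g = 1"
  obtains h p where "contraction T g h p"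
  using assms rooted_treeD(7)[OF assms(1-3)]
  unfolding contraction_def outdegree_eq_card by (metis card_1_singletonE)

text \<open>Every contraction preserves rootedness and the shape at the root, and at the end no
  vertex of outdegree 1 is left. So the shape does not depend on the order of the
  contractions.\<close>

lemma contracts_to_invariants:
  assumes "contracts_to T T'" "rooted_tree T" "has_shape (arcs T) (root T) t"
  shows "topological_tree T' \<and> has_shape (arcs T') (root T') t"
  using assms
proof (induction rule: contracts_to.induct)
  case (finished T)
  then show ?case by (simp add: topological_tree_def)
next
  case (step g T T')
  then obtain h p where "contraction T g h p" by (metis contractionE)
  then interpret contraction T g h p .
  show ?case
    using step.IH[OF rooted_tree_contract_vertex] has_shape_contract_vertex[OF step.prems(2)] step.hyps(2)
    by simp
qed

text \<open>Each contraction removes a vertex and keeps the outdegrees of the others. In particular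
  the root never acquires outdegree 1, so every vertex to be contracted has a parent.\<close>

lemma contracts_to_exists:
  assumes "rooted_tree T" "outdegree T (root T) \<noteq> 1"
  shows "\<exists>T'. contracts_to T T'"
  using assms
proof (induction "card (verts T)" arbitrary: T rule: less_induct)
  case less
  show ?case
  proof (cases "\<forall>v\<in>verts T. outdegree T v \<noteq> 1")
    case True
    then show ?thesis using contracts_to.finished by blast
  next
    case False
    then obtain g where g: "g \<in> verts T" "outdegree T g = 1" by blast
    with less.prems have "g \<noteq> root T" by auto
    with g less.prems(1) obtain h p where "contraction T g h p" by (metis contractionE)
    then interpret contraction T g h p .
    have "card (verts (contract_vertex g T)) < card (verts T)"
      using g(1) rooted_treeD(1)[OF T] by (simp only: verts_contract_vertex card_Diff1_less)
    with less.hyps rooted_tree_contract_vertex outdegree_contract_vertex less.prems(2) \<open>g \<noteq> root T\<close>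
    obtain T' where "contracts_to (contract_vertex g T) T'" by (metis root_contract_vertex)
    with g \<open>g \<noteq> root T\<close> show ?thesis by (metis contracts_to.step)
  qed
qed

section \<open>Leaf-induced subtrees of complete trees\<close>

definition words :: "nat \<Rightarrow> nat \<Rightarrow> nat list set" where
  "words d h = {xs. set xs \<subseteq> {..<d} \<and> length xs = h}"

text \<open>\<open>shape_of h S\<close> is the shape of the subtree induced by a set \<open>S\<close> of words of length \<open>h\<close>.\<close>

primrec shape_of :: "nat \<Rightarrow> nat list set \<Rightarrow> shape" where
  "shape_of 0 S = Node {#}"
| "shape_of (Suc n) S =
     join (image_mset (\<lambda>i. shape_of n {xs. i # xs \<in> S}) (mset_set {i. \<exists>xs. i # xs \<in> S}))"

text \<open>The listed multisets belong to sets of leaves that meet at least two branches. A set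
  inside a single branch has a shape of the lower height, and these reappear by
  \<open>shapes_mono\<close>.\<close>

primrec shapes :: "nat \<Rightarrow> nat \<Rightarrow> shape set" where
  "shapes d 0 = {Node {#}}"
| "shapes d (Suc n) = insert (Node {#}) (Node ` (\<Union>k\<in>{2..d}. multisets_of_size (shapes d n) k))"

lemma Node_in_shapes: "Node {#} \<in> shapes d n"
  by (cases n) auto

lemma shapes_mono: "shapes d n \<subseteq> shapes d (Suc n)"
proof (induction n)
  case (Suc n)
  have "Node ` (\<Union>k\<in>{2..d}. multisets_of_size (shapes d n) k)
      \<subseteq> Node ` (\<Union>k\<in>{2..d}. multisets_of_size (shapes d (Suc n)) k)"
    by (intro image_mono UN_mono multisets_of_size_mono Suc order_refl)
  then show ?case unfolding shapes.simps(2)[of d "Suc n"] by auto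
qed (use Node_in_shapes in simp)

text \<open>The first letters in \<open>S\<close> are the branches it meets. A single branch hands
  its shape through unchanged; two or more, at most \<open>d\<close>, give a node with that many
  children.\<close>

lemma shape_of_in_shapes:
  "S \<noteq> {} \<Longrightarrow> S \<subseteq> words d h \<Longrightarrow> shape_of h S \<in> shapes d h"
proof (induction h arbitrary: S)
  case (Suc n)
  define I where "I = {i. \<exists>xs. i # xs \<in> S}"
  have "I \<subseteq> {..<d}" using Suc.prems(2) by (auto simp: I_def words_def)
  then have fin: "finite I" and "card I \<le> d"
    using finite_subset card_mono[of "{..<d}" I] by auto
  obtain s where "s \<in> S" using Suc.prems(1) by auto
  moreover from this have "length s = Suc n" using Suc.prems(2) by (auto simp: words_def)
  ultimately have "I \<noteq> {}" by (auto simp: I_def length_Suc_conv)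
  have sub: "shape_of n {xs. i # xs \<in> S} \<in> shapes d n" if "i \<in> I" for i
  proof (rule Suc.IH)
    show "{xs. i # xs \<in> S} \<subseteq> words d n"
      using subsetD[OF Suc.prems(2)] by (fastforce simp: words_def)
  qed (use that in \<open>auto simp: I_def\<close>)
  show ?case
  proof (cases "card I = 1")
    case True
    then obtain i where "I = {i}" by (auto simp: card_1_singleton_iff)
    then show ?thesis using sub[of i] shapes_mono[of d n] by (auto simp: I_def)
  next
    case False
    then have "2 \<le> card I" using \<open>I \<noteq> {}\<close> fin by (metis One_nat_def Suc_1 Suc_leI card_gt_0_iff le_neq_implies_less)
    then have "image_mset (\<lambda>i. shape_of n {xs. i # xs \<in> S}) (mset_set I)
        \<in> (\<Union>k\<in>{2..d}. multisets_of_size (shapes d n) k)"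
      using \<open>card I \<le> d\<close> sub fin by (auto simp: multisets_of_size_def)
    then show ?thesis using False by (simp add: join_eq_Node flip: I_def)
  qed
qed simp

lemma shape_of_singleton: "length xs = h \<Longrightarrow> shape_of h {xs} = Node {#}"
  by (induction h arbitrary: xs) (auto simp: length_Suc_conv)

text \<open>A realization of the \<open>i\<close>-th child shape is placed in the
  \<open>i\<close>-th branch, and at most \<open>d\<close> branches are required. The leaf is
  realized by a single word.\<close>

lemma shapes_realized:
  assumes "d \<ge> 1" "t \<in> shapes d h"
  shows "\<exists>S. S \<noteq> {} \<and> S \<subseteq> words d h \<and> shape_of h S = t"
  using assms(2)
proof (induction h arbitrary: t)
  case 0
  then show ?case by (intro exI[of _ "{[]}"]) (auto simp: words_def)
next
  case (Suc n)
  then consider "t = Node {#}" | M where "t = Node M" "2 \<le> size M" "size M \<le> d" "set_mset M \<subseteq> shapes d n"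
    by (auto simp: multisets_of_size_def)
  then show ?case
  proof cases
    case 1
    have "shape_of (Suc n) {replicate (Suc n) 0} = t" by (subst shape_of_singleton) (auto simp: 1)
    then show ?thesis using assms(1) by (intro exI[of _ "{replicate (Suc n) 0}"]) (auto simp: words_def)
  next
    case 2
    obtain F where F: "\<And>s. s \<in> shapes d n \<Longrightarrow> F s \<noteq> {} \<and> F s \<subseteq> words d n \<and> shape_of n (F s) = s"
      using Suc.IH by metis
    obtain ms where ms: "mset ms = M" by (metis ex_mset)
    define S where "S = {i # xs | i xs. i < length ms \<and> xs \<in> F (ms ! i)}"
    have nth: "ms ! i \<in> shapes d n" if "i < length ms" for i
      using that ms 2(4) by (metis nth_mem_mset subsetD)
    have "length ms \<le> d" "2 \<le> length ms" using 2 ms by auto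
    have I: "{i. \<exists>xs. i # xs \<in> S} = {..<length ms}"
      using F nth by (fastforce simp: S_def)
    have "shape_of n {xs. i # xs \<in> S} = ms ! i" if "i < length ms" for i
      using F[OF nth[OF that]] that by (simp add: S_def)
    then have "image_mset (\<lambda>i. shape_of n {xs. i # xs \<in> S}) (mset_set {..<length ms})
        = image_mset (\<lambda>i. ms ! i) (mset_set {..<length ms})"
      by (intro image_mset_cong) auto
    also have "\<dots> = mset (map (\<lambda>i. ms ! i) [0..<length ms])"
      by (simp add: lessThan_atLeast0)
    also have "\<dots> = M" by (simp only: map_nth ms)
    finally have "shape_of (Suc n) S = t"
      using 2 by (simp add: I join_eq_Node)
    moreover have "0 \<in> {i. \<exists>xs. i # xs \<in> S}" unfolding I using \<open>2 \<le> length ms\<close> by (cases ms) auto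
    then have "S \<noteq> {}" by blast
    moreover have "S \<subseteq> words d (Suc n)"
      using F nth \<open>length ms \<le> d\<close> by (fastforce simp: S_def words_def)
    ultimately show ?thesis by blast
  qed
qed

lemma finite_shapes: "finite (shapes d n)"
  by (induction n) auto

text \<open>Hockey-stick summation: with \<open>a = Suc r\<close> shapes there are
  \<open>(r + k) choose k\<close> multisets of size \<open>k\<close>, and summing over
  \<open>k \<le> d\<close> gives \<open>(d + a) choose d\<close>. The term for \<open>k = 0\<close>
  accounts for the leaf, the term for \<open>k = 1\<close> for the summand \<open>a\<close> on the
  left.\<close>

lemma card_shapes_Suc:
  assumes "d \<ge> 2"
  shows "card (shapes d (Suc n)) + card (shapes d n) = (d + card (shapes d n)) choose d"
proof -
  define a where "a = card (shapes d n)"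
  have "a > 0" using Node_in_shapes[of d n] finite_shapes[of d n] by (auto simp: a_def card_gt_0_iff)
  then obtain r where r: "a = Suc r" by (cases a) auto
  let ?U = "\<Union>k\<in>{2..d}. multisets_of_size (shapes d n) k"
  have "card ?U = (\<Sum>k\<in>{2..d}. card (multisets_of_size (shapes d n) k))"
  proof (rule card_UN_disjoint)
    show "\<forall>k\<in>{2..d}. finite (multisets_of_size (shapes d n) k)"
      using finite_multisets_of_size[OF finite_shapes] by blast
  qed (auto simp: multisets_of_size_def)
  also have "\<dots> = (\<Sum>k\<in>{2..d}. (r + k) choose k)"
    using r by (simp add: card_multisets_of_size finite_shapes flip: a_def)
  finally have U: "card ?U = (\<Sum>k\<in>{2..d}. (r + k) choose k)" .
  have "{..d} = insert 0 (insert 1 {2..d})" using assms by auto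
  then have "(\<Sum>k\<le>d. (r + k) choose k) = 1 + (a + card ?U)"
    unfolding U r by simp
  moreover have "card (shapes d (Suc n)) = Suc (card (Node ` ?U))"
  proof -
    have "Node {#} \<notin> Node ` ?U" by (auto simp: multisets_of_size_def)
    moreover have "finite ?U" by (auto simp: finite_shapes)
    ultimately show ?thesis unfolding shapes.simps(2) by (intro card_insert_disjoint finite_imageI)
  qed
  moreover have "card (Node ` ?U) = card ?U" by (intro card_image) (simp add: inj_on_def)
  ultimately show ?thesis
    using sum_choose_lower[of r d] r by (simp add: a_def add_ac)
qed

section \<open>The spanned subtree of a set of words\<close>

lemma ancestor_complete_tree_iff:
  assumes "v \<in> verts (complete_tree d h)"
  shows "ancestor (complete_tree d h) u v \<longleftrightarrow> prefix u v"
proof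
  assume "ancestor (complete_tree d h) u v"
  then show "prefix u v"
    unfolding ancestor_def
    by (induction rule: rtrancl_induct) (auto simp: complete_tree_arc_iff prefix_def)
next
  assume "prefix u v"
  then obtain ys where "v = u @ ys" by (auto simp: prefix_def)
  with assms show "ancestor (complete_tree d h) u v"
  proof (induction ys arbitrary: v rule: rev_induct)
    case (snoc i ys)
    then have "ancestor (complete_tree d h) u (u @ ys)"
      and "(u @ ys, v) \<in> arcs (complete_tree d h)"
      by (auto simp: complete_tree_def)
    then show ?case unfolding ancestor_def by (rule rtrancl_into_rtrancl)
  qed (simp add: ancestor_def)
qed

text \<open>Along the letters of \<open>m\<close> only one branch is met, and \<open>join\<close>
  returns a single shape unchanged. Thus the shape of \<open>S\<close> can be read off at the most
  recent common ancestor.\<close>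

lemma shape_of_common_prefix:
  assumes "S \<noteq> {}" "\<And>s. s \<in> S \<Longrightarrow> prefix m s \<and> length s = h"
  shows "shape_of h S = shape_of (h - length m) {xs. m @ xs \<in> S}"
  using assms
proof (induction m arbitrary: h S)
  case (Cons i m)
  obtain s where "s \<in> S" using Cons.prems(1) by auto
  with Cons.prems(2)[of s] obtain n where n: "h = Suc n" by (auto simp: prefix_def)
  have i: "{j. \<exists>xs. j # xs \<in> S} = {i}"
    using Cons.prems \<open>s \<in> S\<close> by (fastforce simp: prefix_def)
  then have ne: "{xs. i # xs \<in> S} \<noteq> {}" by blast
  have "shape_of n {xs. i # xs \<in> S} = shape_of (n - length m) {xs. m @ xs \<in> {xs. i # xs \<in> S}}"
    using Cons.prems(2) n by (intro Cons.IH ne) fastforce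
  then show ?case by (simp add: n i)
qed simp

locale induced =
  fixes d h :: nat and S :: "nat list set"
  assumes S: "S \<noteq> {}" "S \<subseteq> words d h"
begin

abbreviation "m \<equiv> Longest_common_prefix S"

abbreviation "T \<equiv> spanned_subtree (complete_tree d h) S"

lemma S_verts: "s \<in> S \<Longrightarrow> prefix v s \<Longrightarrow> v \<in> verts (complete_tree d h)"
  using S(2) by (fastforce simp: words_def complete_tree_def prefix_def)

lemma m_prefix: "s \<in> S \<Longrightarrow> prefix m s"
  by (rule Longest_common_prefix_prefix)

text \<open>Common ancestors of \<open>S\<close> are its common prefixes, and all of these are
  prefixes of the longest one.\<close>

lemma mrca_eq: "mrca (complete_tree d h) S = m"
proof -
  have common: "common_ancestor (complete_tree d h) S b \<longleftrightarrow> (\<forall>s\<in>S. prefix b s)" for b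
    using S(1) S_verts ancestor_complete_tree_iff unfolding common_ancestor_def
    by (meson all_not_in_conv order_refl prefix_order.order_refl)
  have m: "m \<in> verts (complete_tree d h)" using S(1) m_prefix S_verts by blast
  show ?thesis
    unfolding mrca_def common
  proof (rule the_equality)
    show "(\<forall>s\<in>S. prefix m s) \<and> (\<forall>b. (\<forall>s\<in>S. prefix b s) \<longrightarrow> ancestor (complete_tree d h) b m)"
      using m_prefix Longest_common_prefix_max_prefix[OF S(1)] ancestor_complete_tree_iff[OF m] by blast
    fix a
    assume a: "(\<forall>s\<in>S. prefix a s) \<and> (\<forall>b. (\<forall>s\<in>S. prefix b s) \<longrightarrow> ancestor (complete_tree d h) b a)"
    then have "a \<in> verts (complete_tree d h)" using S(1) S_verts by blast
    with a m_prefix have "prefix m a" using ancestor_complete_tree_iff by blast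
    moreover have "prefix a m" using a Longest_common_prefix_max_prefix[OF S(1)] by blast
    ultimately show "a = m" by simp
  qed
qed

lemma spanned:
  "root T = m"
  "v \<in> verts T \<longleftrightarrow> prefix m v \<and> (\<exists>s\<in>S. prefix v s)"
  "(u, v) \<in> arcs T \<longleftrightarrow> (\<exists>i. v = u @ [i]) \<and> prefix m u \<and> (\<exists>s\<in>S. prefix v s)"
proof -
  have anc: "(\<exists>s\<in>S. ancestor (complete_tree d h) v s) \<longleftrightarrow> (\<exists>s\<in>S. prefix v s)" for v
    using S_verts ancestor_complete_tree_iff by blast
  show "root T = m" by (simp add: spanned_subtree_def mrca_eq)
  show "v \<in> verts T \<longleftrightarrow> prefix m v \<and> (\<exists>s\<in>S. prefix v s)"
    using S_verts ancestor_complete_tree_iff by (auto simp: spanned_subtree_def mrca_eq anc)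
  have arc: "(u, v) \<in> arcs (complete_tree d h) \<longleftrightarrow> (\<exists>i. v = u @ [i])"
    if "v \<in> verts (complete_tree d h)" for u v
    using that by (auto simp: complete_tree_def)
  have "u \<in> verts (complete_tree d h)" if "prefix (u @ [i]) s" "s \<in> S" for u i s
    using S_verts that append_prefixD by blast
  then show "(u, v) \<in> arcs T \<longleftrightarrow> (\<exists>i. v = u @ [i]) \<and> prefix m u \<and> (\<exists>s\<in>S. prefix v s)"
    using S_verts ancestor_complete_tree_iff arc by (auto simp: spanned_subtree_def mrca_eq anc; blast)
qed

lemma rooted_tree_spanned: "rooted_tree T"
proof -
  have "verts T \<subseteq> verts (complete_tree d h)" using S_verts by (auto simp: spanned)
  moreover have "finite (verts (complete_tree d h))"
    using rooted_tree_complete_tree rooted_treeD(1) by blast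
  ultimately have "finite (verts T)" by (rule finite_subset)
  moreover have "m \<in> verts T" using S(1) m_prefix by (auto simp: spanned)
  moreover have "arcs T \<subseteq> verts T \<times> verts T"
    by (fastforce simp: spanned dest: append_prefixD)
  moreover have "(u, m) \<notin> arcs T" for u
    using prefix_length_le[of m u] by (auto simp: spanned)
  moreover have parent: "\<exists>!u. (u, v) \<in> arcs T" if v: "v \<in> verts T" "v \<noteq> m" for v
  proof -
    from v have "prefix m v" by (simp add: spanned)
    with v(2) obtain ys i where "v = m @ ys @ [i]" by (metis append_Nil2 prefix_def rev_exhaust)
    with v show ?thesis by (intro ex1I[of _ "m @ ys"]) (auto simp: spanned)
  qed
  moreover have "(m, v) \<in> (arcs T)\<^sup>*" if "v \<in> verts T" for v
  proof -
    from that obtain ys where "v = m @ ys" by (auto simp: spanned prefix_def)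
    with that show ?thesis
    proof (induction ys arbitrary: v rule: rev_induct)
      case (snoc i ys)
      then have "(m @ ys, v) \<in> arcs T" by (auto simp: spanned)
      moreover have "m @ ys \<in> verts T"
        using snoc.prems by (auto simp: spanned) (metis append_assoc append_prefixD)
      ultimately show ?case using snoc.IH by (metis rtrancl_into_rtrancl)
    qed simp
  qed
  ultimately show ?thesis unfolding rooted_tree_def spanned(1) by blast
qed

lemma length_S: "s \<in> S \<Longrightarrow> length s = h"
  using S(2) by (auto simp: words_def)

text \<open>With only one child of the root, all words of \<open>S\<close> would continue
  \<open>m\<close> by the same letter, although \<open>m\<close> is the longest common
  prefix.\<close>

lemma outdegree_root: "outdegree T (root T) \<noteq> 1"
proof
  assume "outdegree T (root T) = 1"
  then obtain v where "arcs T `` {m} = {v}"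
    by (auto simp: outdegree_eq_card spanned(1) card_1_singleton_iff)
  then have v: "(m, w) \<in> arcs T \<longleftrightarrow> w = v" for w by auto
  then obtain i s where i: "v = m @ [i]" and s: "s \<in> S" "prefix v s" using spanned(3) by metis
  have "prefix v t" if "t \<in> S" for t
  proof -
    obtain ys where ys: "t = m @ ys" using m_prefix[OF \<open>t \<in> S\<close>] by (auto simp: prefix_def)
    \<comment> \<open>All words of \<open>S\<close> have the same length \<open>h\<close>, so one
      that is longer than \<open>m\<close> forces \<open>t\<close> to extend \<open>m\<close>
      properly.\<close>
    have "length m < length s" using s(2) i prefix_length_le by fastforce
    then have "ys \<noteq> []" using length_S[OF s(1)] length_S[OF that] ys by auto
    then obtain j zs where "ys = j # zs" by (cases ys) auto
    then have "prefix (m @ [j]) t" using ys by (simp add: prefix_def)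
    then have "(m, m @ [j]) \<in> arcs T" using that by (auto simp: spanned)
    then show ?thesis using v \<open>prefix (m @ [j]) t\<close> by metis
  qed
  then have "length v \<le> length m" using Longest_common_prefix_longest[OF S(1)] by blast
  then show False using i by simp
qed

text \<open>Induction on the remaining height: the children of \<open>v\<close> are the one-letter
  extensions that still begin a word of \<open>S\<close>, which are exactly the branches in the
  recursion of \<open>shape_of\<close>.\<close>

lemma has_shape_spanned:
  "v \<in> verts T \<Longrightarrow> has_shape (arcs T) v (shape_of (h - length v) {xs. v @ xs \<in> S})"
proof (induction "h - length v" arbitrary: v)
  case 0
  have "arcs T `` {v} = {}"
  proof -
    have "\<not> prefix (v @ [i]) s" if "s \<in> S" for i s
      using prefix_length_le[of "v @ [i]" s] length_S[OF that] 0 by auto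
    then show ?thesis by (auto simp: spanned)
  qed
  then show ?case using has_shape_Image[of "{}" "arcs T" "\<lambda>_. Node {#}" v "{#}"] 0
    by (simp add: join_eq_Node flip: 0(1))
next
  case (Suc n)
  let ?f = "\<lambda>w. shape_of n {xs. w @ xs \<in> S}"
  let ?I = "{i. \<exists>xs. i # xs \<in> {xs. v @ xs \<in> S}}"
  have "(\<exists>s\<in>S. prefix (v @ [i]) s) \<longleftrightarrow> i \<in> ?I" for i
    by (simp add: prefix_def) blast
  moreover have "prefix m v" using Suc.prems by (simp add: spanned)
  ultimately have "(v, w) \<in> arcs T \<longleftrightarrow> (\<exists>i. w = v @ [i] \<and> i \<in> ?I)" for w
    unfolding spanned by blast
  then have children: "arcs T `` {v} = (\<lambda>i. v @ [i]) ` ?I" by blast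
  have eq: "image_mset ?f (mset_set ((\<lambda>i. v @ [i]) ` ?I)) = image_mset (\<lambda>i. ?f (v @ [i])) (mset_set ?I)"
    by (subst image_mset_mset_set[symmetric]) (auto simp: inj_on_def multiset.map_comp comp_def)
  have "has_shape (arcs T) w (?f w)" if "w \<in> (\<lambda>i. v @ [i]) ` ?I" for w
  proof -
    have "w \<in> verts T" "n = h - length w"
      using that Suc.hyps(2) rooted_treeD(5)[OF rooted_tree_spanned] unfolding children[symmetric]
      by (auto simp: spanned(3))
    then show ?thesis using Suc.hyps(1) by metis
  qed
  from has_shape_Image[OF this children eq] show ?case
    by (simp flip: Suc.hyps(2))
qed

lemma has_shape_root: "has_shape (arcs T) (root T) (shape_of h S)"
proof -
  have "m \<in> verts T" using S(1) m_prefix by (auto simp: spanned)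
  from has_shape_spanned[OF this] show ?thesis
    using shape_of_common_prefix[OF S(1), of m h] m_prefix length_S by (simp add: spanned(1))
qed

end

section \<open>Counting isomorphism classes by shapes\<close>

lemma leaves_complete_tree: "d \<ge> 1 \<Longrightarrow> leaves (complete_tree d h) = words d h"
proof (rule set_eqI)
  show "xs \<in> leaves (complete_tree d h) \<longleftrightarrow> xs \<in> words d h" if "d \<ge> 1" for xs
  proof (cases "xs \<in> verts (complete_tree d h)")
    case True
    then have "outdegree (complete_tree d h) xs = 0 \<longleftrightarrow> length xs = h"
      using that by (simp add: outdegree_complete_tree) (simp add: complete_tree_def)
    with True show ?thesis by (simp add: leaves_def) (auto simp: complete_tree_def words_def)
  qed (auto simp: leaves_def words_def complete_tree_def)
qed

text \<open>The classes are the nonempty fibres of \<open>f\<close>, which correspond to its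
  values.\<close>

lemma card_quotient_kernel:
  "card (L // {(x, y). x \<in> L \<and> y \<in> L \<and> f x = f y}) = card (f ` L)"
proof -
  have "L // {(x, y). x \<in> L \<and> y \<in> L \<and> f x = f y} = (\<lambda>t. {x \<in> L. f x = t}) ` f ` L"
    unfolding quotient_def image_image UNION_singleton_eq_range by (intro image_cong) auto
  moreover have "inj_on (\<lambda>t. {x \<in> L. f x = t}) (f ` L)"
    by (auto simp: inj_on_def)
  ultimately show ?thesis by (simp add: card_image)
qed

theorem num_leaf_induced_eq_card_shapes:
  assumes "d \<ge> 1"
  shows "num_leaf_induced (complete_tree d h) = card (shapes d h)"
proof -
  define L where "L = leaf_induced_subtrees (complete_tree d h)"
  define f where "f A = (THE t. has_shape (arcs A) (root A) t)" for A :: "nat list rtree"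
  have f: "f A = t" if "has_shape (arcs A) (root A) t" for A t
    unfolding f_def using that has_shape_unique[OF _ that] by (rule the_equality)
  have L: "A \<in> L \<longleftrightarrow> (\<exists>S. induced d h S \<and> contracts_to (spanned_subtree (complete_tree d h) S) A)" for A
    using assms by (auto simp: L_def leaf_induced_subtrees_def leaves_complete_tree induced_def)
  have inv: "topological_tree A \<and> has_shape (arcs A) (root A) (shape_of h S)"
    if "induced d h S" "contracts_to (spanned_subtree (complete_tree d h) S) A" for A S
    using contracts_to_invariants that induced.rooted_tree_spanned induced.has_shape_root by blast
  have iso: "rtree_iso A B \<longleftrightarrow> f A = f B" if "A \<in> L" "B \<in> L" for A B
  proof -
    from that inv L obtain s t where "topological_tree A" "has_shape (arcs A) (root A) s"
      and "topological_tree B" "has_shape (arcs B) (root B) t" by metis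
    then show ?thesis
      using rtree_iso_imp_same_shape same_shape_imp_rtree_iso f unfolding topological_tree_def by metis
  qed
  have "f ` L = shapes d h"
  proof (intro equalityI subsetI)
    fix t assume "t \<in> f ` L"
    then obtain A where "A \<in> L" and t: "t = f A" by blast
    then obtain S where S: "induced d h S" "contracts_to (spanned_subtree (complete_tree d h) S) A"
      using L by blast
    then have "t = shape_of h S" using inv f t by blast
    then show "t \<in> shapes d h" using S(1) shape_of_in_shapes by (simp add: induced_def)
  next
    fix t assume "t \<in> shapes d h"
    then obtain S where S: "induced d h S" "shape_of h S = t"
      using shapes_realized[OF assms] by (metis induced_def)
    \<comment> \<open>Any complete sequence of contractions serves, since by \<open>inv\<close> its
      result has the shape of \<open>S\<close>.\<close>
    obtain A where A: "contracts_to (spanned_subtree (complete_tree d h) S) A"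
      using contracts_to_exists induced.rooted_tree_spanned[OF S(1)] induced.outdegree_root[OF S(1)] by blast
    then have "f A = t" using inv[OF S(1) A] f S(2) by blast
    moreover have "A \<in> L" using A S(1) L by blast
    ultimately show "t \<in> f ` L" by blast
  qed
  moreover have "{(A, B). A \<in> L \<and> B \<in> L \<and> rtree_iso A B} = {(A, B). A \<in> L \<and> B \<in> L \<and> f A = f B}"
    using iso by blast
  ultimately show ?thesis
    unfolding num_leaf_induced_def L_def[symmetric] by (simp only: card_quotient_kernel)
qed

section \<open>Computability\<close>

text \<open>\<open>recursive_fun\<close> fixes a function on all lists, although only lists of
  length \<open>k\<close> matter. Asking for agreement on those lists lets functions be rewritten
  freely.\<close>

definition recursive_on :: "nat \<Rightarrow> (nat list \<Rightarrow> nat) \<Rightarrow> bool" where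
  "recursive_on k f \<longleftrightarrow> (\<exists>g. recursive_fun k g \<and> (\<forall>xs. length xs = k \<longrightarrow> g xs = f xs))"

lemma recursive_on_cong:
  "recursive_on k f \<Longrightarrow> (\<And>xs. length xs = k \<Longrightarrow> f xs = g xs) \<Longrightarrow> recursive_on k g"
  unfolding recursive_on_def by metis

lemma recursive_on_proj: "i < k \<Longrightarrow> recursive_on k (\<lambda>xs. xs ! i)"
  unfolding recursive_on_def using recursive_fun.proj by blast

lemma recursive_on_comp1:
  assumes "recursive_on 1 f" "recursive_on k g"
  shows "recursive_on k (\<lambda>xs. f [g xs])"
proof -
  obtain f' g' where f: "recursive_fun 1 f'" "\<And>xs. length xs = 1 \<Longrightarrow> f' xs = f xs"
    and g: "recursive_fun k g'" "\<And>xs. length xs = k \<Longrightarrow> g' xs = g xs"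
    using assms unfolding recursive_on_def by metis
  have "recursive_fun k (\<lambda>xs. f' (map (\<lambda>g. g xs) [g']))"
    by (rule recursive_fun.comp) (use f g in auto)
  then show ?thesis
    unfolding recursive_on_def using f(2) g(2) by (intro exI conjI) auto
qed

lemma recursive_on_comp2:
  assumes "recursive_on 2 f" "recursive_on k g" "recursive_on k h"
  shows "recursive_on k (\<lambda>xs. f [g xs, h xs])"
proof -
  obtain f' g' h' where f: "recursive_fun 2 f'" "\<And>xs. length xs = 2 \<Longrightarrow> f' xs = f xs"
    and g: "recursive_fun k g'" "\<And>xs. length xs = k \<Longrightarrow> g' xs = g xs"
    and h: "recursive_fun k h'" "\<And>xs. length xs = k \<Longrightarrow> h' xs = h xs"
    using assms unfolding recursive_on_def by metis
  have "recursive_fun k (\<lambda>xs. f' (map (\<lambda>g. g xs) [g', h']))"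
    by (rule recursive_fun.comp) (use f g h in \<open>auto simp: numeral_2_eq_2\<close>)
  then show ?thesis
    unfolding recursive_on_def using f(2) g(2) h(2) by (intro exI conjI) auto
qed

lemma recursive_on_Suc: "recursive_on k f \<Longrightarrow> recursive_on k (\<lambda>xs. Suc (f xs))"
  using recursive_on_comp1[of "\<lambda>xs. Suc (xs ! 0)" k f] recursive_fun.succ
  unfolding recursive_on_def by auto

lemma recursive_on_const: "recursive_on k (\<lambda>xs. n)"
proof (induction n)
  case 0
  then show ?case unfolding recursive_on_def using recursive_fun.zero by blast
qed (rule recursive_on_Suc)

lemma recursive_on_prim_rec:
  assumes "recursive_on k f" "recursive_on (Suc (Suc k)) g"
  shows "recursive_on (Suc k) (\<lambda>xs. rec_nat (f (tl xs)) (\<lambda>n y. g (n # y # tl xs)) (hd xs))"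
proof -
  obtain f' g' where f: "recursive_fun k f'" "\<And>xs. length xs = k \<Longrightarrow> f' xs = f xs"
    and g: "recursive_fun (Suc (Suc k)) g'" "\<And>xs. length xs = Suc (Suc k) \<Longrightarrow> g' xs = g xs"
    using assms unfolding recursive_on_def by metis
  have "rec_nat (f' ys) (\<lambda>n y. g' (n # y # ys)) m = rec_nat (f ys) (\<lambda>n y. g (n # y # ys)) m"
    if "length ys = k" for m ys
    by (induction m) (use that f(2) g(2) in auto)
  with recursive_fun.prim_rec[OF f(1) g(1)] show ?thesis
    unfolding recursive_on_def by (intro exI conjI) auto
qed

lemma recursive_on_rec_unary:
  assumes "recursive_on 2 (\<lambda>xs. g (xs ! 0) (xs ! 1))"
  shows "recursive_on 1 (\<lambda>xs. rec_nat c g (xs ! 0))"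
proof -
  have "recursive_on (Suc 0) (\<lambda>xs. rec_nat c (\<lambda>n y. g ((n # y # tl xs) ! 0) ((n # y # tl xs) ! 1)) (hd xs))"
    using recursive_on_prim_rec[OF recursive_on_const[of 0 c], of "\<lambda>xs. g (xs ! 0) (xs ! 1)"] assms
    by (simp add: numeral_2_eq_2)
  then have "recursive_on 1 (\<lambda>xs. rec_nat c (\<lambda>n y. g ((n # y # tl xs) ! 0) ((n # y # tl xs) ! 1)) (hd xs))"
    by simp
  then show ?thesis
    by (rule recursive_on_cong) (auto simp: length_Suc_conv)
qed

text \<open>Recursion on the first argument with the second as a parameter, the pattern behind
  addition, multiplication, powers and truncated subtraction.\<close>

lemma recursive_on_rec_binary:
  assumes "recursive_on 1 (\<lambda>xs. f (xs ! 0))"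
    "recursive_on 3 (\<lambda>xs. g (xs ! 0) (xs ! 1) (xs ! 2))"
  shows "recursive_on 2 (\<lambda>xs. rec_nat (f (xs ! 1)) (\<lambda>n y. g n y (xs ! 1)) (xs ! 0))"
proof -
  have "recursive_on (Suc 1) (\<lambda>xs. rec_nat (f (tl xs ! 0))
     (\<lambda>n y. g ((n # y # tl xs) ! 0) ((n # y # tl xs) ! 1) ((n # y # tl xs) ! 2)) (hd xs))"
    by (rule recursive_on_prim_rec) (use assms in \<open>simp_all add: numeral_3_eq_3\<close>)
  then have "recursive_on 2 (\<lambda>xs. rec_nat (f (tl xs ! 0))
     (\<lambda>n y. g ((n # y # tl xs) ! 0) ((n # y # tl xs) ! 1) ((n # y # tl xs) ! 2)) (hd xs))"
    by (simp add: numeral_2_eq_2)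
  then show ?thesis
    by (rule recursive_on_cong) (auto simp: numeral_2_eq_2 length_Suc_conv)
qed

lemma recursive_on_binop:
  assumes "recursive_on 2 (\<lambda>xs. F (xs ! 0) (xs ! 1))" "recursive_on k f" "recursive_on k g"
  shows "recursive_on k (\<lambda>xs. F (f xs) (g xs))"
  using recursive_on_comp2[OF assms] by simp

lemma recursive_on_unop:
  assumes "recursive_on 1 (\<lambda>xs. F (xs ! 0))" "recursive_on k f"
  shows "recursive_on k (\<lambda>xs. F (f xs))"
  using recursive_on_comp1[OF assms] by simp

lemma recursive_on_add:
  assumes "recursive_on k f" "recursive_on k g"
  shows "recursive_on k (\<lambda>xs. f xs + g xs)"
proof (rule recursive_on_binop[OF _ assms])
  have "rec_nat b (\<lambda>n y. Suc y) a = a + b" for a b by (induction a) auto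
  then show "recursive_on 2 (\<lambda>xs. xs ! 0 + xs ! 1)"
    using recursive_on_rec_binary[of "\<lambda>x. x" "\<lambda>n y z. Suc y"]
    by (simp add: recursive_on_proj recursive_on_Suc)
qed

lemma recursive_on_mult:
  assumes "recursive_on k f" "recursive_on k g"
  shows "recursive_on k (\<lambda>xs. f xs * g xs)"
proof (rule recursive_on_binop[OF _ assms])
  have "rec_nat 0 (\<lambda>n y. y + b) a = a * b" for a b :: nat by (induction a) auto
  then show "recursive_on 2 (\<lambda>xs. xs ! 0 * xs ! 1)"
    using recursive_on_rec_binary[of "\<lambda>x. 0" "\<lambda>n y z. y + z"]
    by (simp add: recursive_on_proj recursive_on_add recursive_on_const)
qed

lemma recursive_on_power:
  assumes "recursive_on k f" "recursive_on k g"
  shows "recursive_on k (\<lambda>xs. f xs ^ g xs)"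
\<comment> \<open>The arguments are swapped because the recursion runs over the exponent.\<close>
proof (rule recursive_on_binop[OF _ assms(2,1)])
  have "rec_nat 1 (\<lambda>n y. y * b) a = b ^ a" for a b :: nat by (induction a) auto
  then show "recursive_on 2 (\<lambda>xs. xs ! 1 ^ xs ! 0)"
    using recursive_on_rec_binary[of "\<lambda>x. 1" "\<lambda>n y z. y * z"]
    by (simp add: recursive_on_proj recursive_on_mult recursive_on_const)
qed

lemma recursive_on_diff:
  assumes "recursive_on k f" "recursive_on k g"
  shows "recursive_on k (\<lambda>xs. f xs - g xs)"
proof (rule recursive_on_binop[OF _ assms(2,1)])
  \<comment> \<open>The predecessor is the recursion that returns its counter; subtraction iterates
    it, with recursion over the subtrahend.\<close>
  have "rec_nat 0 (\<lambda>n y. n) a = a - 1" for a by (induction a) auto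
  then have pred: "recursive_on k (\<lambda>xs. f xs - 1)" if "recursive_on k f" for k f
    using recursive_on_unop[OF recursive_on_rec_unary[of "\<lambda>n y. n" 0] that]
    by (simp add: recursive_on_proj)
  have "rec_nat b (\<lambda>n y. y - 1) a = b - a" for a b :: nat by (induction a) auto
  then show "recursive_on 2 (\<lambda>xs. xs ! 1 - xs ! 0)"
    using recursive_on_rec_binary[of "\<lambda>x. x" "\<lambda>n y z. y - 1"] pred[of 3 "\<lambda>xs. xs ! 1"]
    by (simp add: recursive_on_proj)
qed

lemmas recursive_on_intros = recursive_on_proj recursive_on_const recursive_on_Suc
  recursive_on_add recursive_on_mult recursive_on_power recursive_on_diff

text \<open>The recursion is \<open>(x + 1 + Suc d choose Suc d) = (x + Suc d choose Suc d) + (x + 1 + d choose d)\<close>.\<close>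

lemma recursive_on_choose: "recursive_on 1 (\<lambda>xs. (d + xs ! 0) choose d)"
proof (induction d)
  case (Suc d)
  have "rec_nat 1 (\<lambda>n y. y + ((d + Suc n) choose d)) x = (Suc d + x) choose Suc d" for x
    by (induction x) auto
  moreover have "recursive_on 2 (\<lambda>xs. xs ! 1 + ((d + Suc (xs ! 0)) choose d))"
    using recursive_on_unop[OF Suc.IH, of 2 "\<lambda>xs. Suc (xs ! 0)"]
    by (intro recursive_on_add recursive_on_Suc recursive_on_proj) (auto simp: recursive_on_intros)
  ultimately show ?case
    using recursive_on_rec_unary[of "\<lambda>n y. y + ((d + Suc n) choose d)" 1] by simp
qed (simp add: recursive_on_const)

lemma recursive_on_minimize:
  assumes "recursive_on (Suc k) f" "\<And>xs. length xs = k \<Longrightarrow> \<exists>n. f (n # xs) = 0"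
  shows "recursive_on k (\<lambda>xs. LEAST n. f (n # xs) = 0)"
proof -
  obtain f' where f: "recursive_fun (Suc k) f'" "\<And>xs. length xs = Suc k \<Longrightarrow> f' xs = f xs"
    using assms unfolding recursive_on_def by metis
  with assms(2) have "recursive_fun k (\<lambda>xs. LEAST n. f' (n # xs) = 0)"
    by (intro recursive_fun.minimize) auto
  then show ?thesis
    unfolding recursive_on_def using f(2) by (intro exI conjI) auto
qed

lemma computable_fun_iff: "computable_fun f \<longleftrightarrow> recursive_on 1 (\<lambda>xs. f (xs ! 0))"
proof
  assume "computable_fun f"
  then obtain g where "recursive_fun 1 g" "\<forall>n. f n = g [n]"
    unfolding computable_fun_def by auto
  then show "recursive_on 1 (\<lambda>xs. f (xs ! 0))"
    unfolding recursive_on_def by (intro exI[of _ g]) (auto simp: length_Suc_conv)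
next
  assume "recursive_on 1 (\<lambda>xs. f (xs ! 0))"
  then obtain g where "recursive_fun 1 g" "\<forall>xs. length xs = 1 \<longrightarrow> g xs = f (xs ! 0)"
    unfolding recursive_on_def by auto
  then show "computable_fun f"
    unfolding computable_fun_def by (intro exI[of _ g]) auto
qed

text \<open>Taking the \<open>d ^ h\<close>-th root of \<open>a h\<close> shrinks the bounded relative error to \<open>O(1 / d ^ h)\<close>;
  \<open>p n\<close> is that root at \<open>h = n + C\<close>, scaled by \<open>2 ^ (n + 1)\<close> and rounded down.\<close>

lemma computable_real_doubly_exponential:
  fixes a :: "nat \<Rightarrow> nat" and \<kappa> L :: real and d :: nat
  assumes a: "computable_fun a" and pos: "\<And>h. a h > 0" and "\<kappa> > 0" and "d \<ge> 2"
    and L: "\<And>h. \<bar>ln (real (a h)) - real d ^ h * ln \<kappa>\<bar> \<le> L"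
  shows "computable_real \<kappa>"
proof -
  have "L \<ge> 0" using L[of 0] by linarith
  \<comment> \<open>The summand \<open>2 * L\<close> will give
    \<open>\<bar>w\<bar> \<le> 1 / 2\<close> below; the summand \<open>4 * \<kappa> * L\<close>
    makes the error of the root at most half of what is allowed.\<close>
  obtain C :: nat where "2 * L + 4 * \<kappa> * L < 2 ^ C"
    using real_arch_pow[of 2 "2 * L + 4 * \<kappa> * L"] by auto
  then have C: "2 * L \<le> 2 ^ C" "4 * \<kappa> * L \<le> 2 ^ C"
    using \<open>L \<ge> 0\<close> \<open>\<kappa> > 0\<close> by (smt (verit) mult_nonneg_nonneg)+
  define E where "E n = d ^ (n + C)" for n
  define B where "B n = a (n + C) * 2 ^ (Suc n * E n)" for n
  \<comment> \<open>Truncated subtraction expresses \<open>B n < Suc m ^ E n\<close> as a vanishing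
    condition, the form that minimization takes. The least such \<open>m\<close> is the integer part
    of the \<open>E n\<close>-th root of \<open>B n\<close>.\<close>
  define p where "p n = (LEAST m. Suc (B n) - Suc m ^ E n = 0)" for n
  have E: "E n > 0" for n using \<open>d \<ge> 2\<close> by (simp add: E_def)
  have ex: "\<exists>m. Suc (B n) - Suc m ^ E n = 0" for n
  proof
    have "Suc (B n) ^ 1 \<le> Suc (B n) ^ E n" using E[of n] by (intro power_increasing) auto
    then show "Suc (B n) - Suc (B n) ^ E n = 0" by simp
  qed
  have "recursive_on 1 (\<lambda>xs. LEAST m. Suc (B ((m # xs) ! 1)) - Suc ((m # xs) ! 0) ^ E ((m # xs) ! 1) = 0)"
  proof (rule recursive_on_minimize)
    show "recursive_on (Suc 1) (\<lambda>xs. Suc (B (xs ! 1)) - Suc (xs ! 0) ^ E (xs ! 1))"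
      unfolding B_def E_def
      by (intro recursive_on_intros recursive_on_unop[OF a[unfolded computable_fun_iff]]) simp_all
    show "\<exists>m. Suc (B ((m # xs) ! 1)) - Suc ((m # xs) ! 0) ^ E ((m # xs) ! 1) = 0"
      if "length xs = 1" for xs
      using ex[of "xs ! 0"] by simp
  qed
  then have cp: "computable_fun p" by (simp add: computable_fun_iff p_def)
  have c0: "computable_fun (\<lambda>_. 0)" by (simp add: computable_fun_iff recursive_on_const)
  have c2: "computable_fun (\<lambda>n. 2 ^ Suc n)"
    unfolding computable_fun_iff by (intro recursive_on_intros) simp
  have "\<bar>\<kappa> - real (p n) / 2 ^ Suc n\<bar> \<le> 1 / 2 ^ n" for n
  proof -
    define z where "z = exp (ln (real (a (n + C))) / E n)"
    have zE: "z ^ E n = a (n + C)"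
      using E[of n] pos[of "n + C"] by (simp add: z_def flip: exp_of_nat_mult)
    have "z > 0" by (simp add: z_def)
    have zB: "(z * 2 ^ Suc n) ^ E n = B n"
      by (simp add: B_def power_mult_distrib zE power_add flip: power_mult)
    have up: "z * 2 ^ Suc n < Suc (p n)"
    proof -
      have "B n < Suc (p n) ^ E n" using LeastI_ex[OF ex[of n]] by (simp add: p_def)
      then have "(z * 2 ^ Suc n) ^ E n < real (Suc (p n)) ^ E n"
        unfolding zB by (metis of_nat_less_iff of_nat_power)
      then show ?thesis by (rule power_less_imp_less_base) simp
    qed
    have lo: "real (p n) \<le> z * 2 ^ Suc n"
    proof (cases "p n")
      case 0
      then show ?thesis using \<open>z > 0\<close> by simp
    next
      case (Suc m)
      then have "m < p n" by simp
      then have "p n ^ E n \<le> B n"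
        using not_less_Least[of m "\<lambda>m. Suc (B n) - Suc m ^ E n = 0"] Suc unfolding p_def by auto
      then have "real (p n) ^ E n \<le> (z * 2 ^ Suc n) ^ E n"
        unfolding zB by (metis of_nat_le_iff of_nat_power)
      with \<open>z > 0\<close> E[of n] show ?thesis by (subst (asm) power_mono_iff) (simp_all del: power_Suc)
    qed
    have 1: "\<bar>z - real (p n) / 2 ^ Suc n\<bar> \<le> 1 / 2 ^ Suc n"
    proof -
      have "real (p n) / 2 ^ Suc n \<le> z" "z \<le> (real (p n) + 1) / 2 ^ Suc n"
        using up lo by (simp_all add: pos_divide_le_eq pos_le_divide_eq del: power_Suc)
      then show ?thesis by (simp add: add_divide_distrib del: power_Suc)
    qed
    \<comment> \<open>\<open>w\<close> is the logarithm of \<open>z / \<kappa>\<close>: taking the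
      root divides the error bound \<open>L\<close> by \<open>E n\<close>, which is at least
      \<open>2 ^ (n + C)\<close>.\<close>
    define w where "w = (ln (real (a (n + C))) - real d ^ (n + C) * ln \<kappa>) / E n"
    have zk: "z = \<kappa> * exp w"
      using E[of n] \<open>\<kappa> > 0\<close> by (simp add: z_def w_def E_def diff_divide_distrib exp_diff)
    have "(2::real) ^ (n + C) \<le> E n"
      using power_mono[of "2::real" d "n + C"] \<open>d \<ge> 2\<close> by (simp add: E_def)
    then have w: "\<bar>w\<bar> \<le> L / 2 ^ (n + C)"
      using L[of "n + C"] \<open>L \<ge> 0\<close> E[of n] unfolding w_def abs_divide by (intro frac_le) auto
    have "2 * L \<le> 2 ^ (n + C)"
      by (rule order_trans[OF C(1)]) (intro power_increasing; simp)
    then have "L / 2 ^ (n + C) \<le> 1 / 2"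
      by (simp add: field_simps)
    with w have "\<bar>w\<bar> \<le> 1 / 2" by linarith
    \<comment> \<open>The upper estimate \<open>exp w \<le> 1 + 2 * \<bar>w\<bar>\<close> uses
      \<open>\<bar>w\<bar> \<le> 1 / 2\<close>; the lower one is
      \<open>1 + w \<le> exp w\<close>.\<close>
    then have "\<bar>exp w - 1\<bar> \<le> 2 * \<bar>w\<bar>"
      using exp_bound_lemma[of w] exp_ge_add_one_self[of w] unfolding real_norm_def by linarith
    then have "\<bar>exp w - 1\<bar> \<le> 2 * (L / 2 ^ (n + C))" using w by linarith
    moreover have "\<kappa> - z = - \<kappa> * (exp w - 1)" by (simp add: zk algebra_simps)
    then have "\<bar>\<kappa> - z\<bar> = \<kappa> * \<bar>exp w - 1\<bar>"
      using \<open>\<kappa> > 0\<close> by (simp add: abs_mult)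
    ultimately have "\<bar>\<kappa> - z\<bar> \<le> \<kappa> * (2 * (L / 2 ^ (n + C)))"
      using \<open>\<kappa> > 0\<close> by (simp only: mult_left_mono less_imp_le)
    also have "\<dots> \<le> 1 / 2 ^ Suc n"
      using C(2) by (simp add: power_add field_simps)
    finally have 2: "\<bar>\<kappa> - z\<bar> \<le> 1 / 2 ^ Suc n" .
    have "\<bar>\<kappa> - real (p n) / 2 ^ Suc n\<bar> \<le> 1 / 2 ^ Suc n + 1 / 2 ^ Suc n"
      using 1 2 by linarith
    then show ?thesis by simp
  qed
  then show ?thesis
    unfolding computable_real_def
    by (intro exI[of _ p] exI[of _ "\<lambda>_. 0"] exI[of _ "\<lambda>n. 2 ^ Suc n"]) (use cp c0 c2 in auto)
qed

section \<open>Asymptotics of the recurrence\<close>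

text \<open>Division by \<open>d ^ h\<close> makes the recurrence telescope with increments
  \<open>e h / d ^ Suc h\<close>. The tail from \<open>h\<close> on is at most
  \<open>1 / d ^ h\<close> times a bound for the later \<open>e j\<close>, so it stays small when
  multiplied by \<open>d ^ h\<close> again.\<close>

lemma affine_recurrence_asymptotics:
  fixes x e :: "nat \<Rightarrow> real" and d :: real
  assumes "d \<ge> 2" and rec: "\<And>h. x (Suc h) = d * x h + e h" and e: "e \<longlonglongrightarrow> 0"
  obtains l where "(\<lambda>h. x h - d ^ h * l) \<longlonglongrightarrow> 0"
proof -
  define y where "y h = x h / d ^ h" for h
  have ySuc: "y (Suc h) = y h + e h / d ^ Suc h" for h
    using \<open>d \<ge> 2\<close> by (simp add: y_def rec field_simps)
  \<comment> \<open>The factor \<open>1 - 1 / 2 ^ k\<close> is the sum of \<open>1 / 2 ^ i\<close>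
    for \<open>1 \<le> i \<le> k\<close>, which dominates the sum of \<open>1 / d ^ i\<close> as
    \<open>d \<ge> 2\<close>.\<close>
  have step: "\<bar>y (h + k) - y h\<bar> \<le> \<eta> / d ^ h * (1 - 1 / 2 ^ k)"
    if "\<And>j. j \<ge> h \<Longrightarrow> \<bar>e j\<bar> \<le> \<eta>" for h k \<eta>
  proof (induction k)
    case (Suc k)
    have "\<eta> \<ge> 0" using that[of h] by linarith
    have "2 ^ Suc k * d ^ h \<le> d ^ Suc (h + k)"
      using \<open>d \<ge> 2\<close> power_mono[of 2 d "Suc k"] by (simp add: power_add)
    then have "\<bar>e (h + k) / d ^ Suc (h + k)\<bar> \<le> \<eta> / (2 ^ Suc k * d ^ h)"
      using that[of "h + k"] \<open>d \<ge> 2\<close> \<open>\<eta> \<ge> 0\<close> unfolding abs_divide by (intro frac_le) auto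
    moreover have "\<bar>y (h + Suc k) - y h\<bar> \<le> \<bar>y (h + k) - y h\<bar> + \<bar>e (h + k) / d ^ Suc (h + k)\<bar>"
      unfolding add_Suc_right ySuc by linarith
    ultimately have "\<bar>y (h + Suc k) - y h\<bar>
        \<le> \<eta> / d ^ h * (1 - 1 / 2 ^ k) + \<eta> / (2 ^ Suc k * d ^ h)"
      using Suc by linarith
    also have "\<dots> = \<eta> / d ^ h * (1 - 1 / 2 ^ Suc k)"
      using \<open>d \<ge> 2\<close> by (simp add: field_simps)
    finally show ?case .
  qed simp
  have bound: "\<bar>y k - y h\<bar> \<le> \<eta> / d ^ h"
    if "\<And>j. j \<ge> h \<Longrightarrow> \<bar>e j\<bar> \<le> \<eta>" "k \<ge> h" for h k \<eta>
  proof -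
    have "\<eta> / d ^ h \<ge> 0" using that(1)[of h] \<open>d \<ge> 2\<close> by simp
    then have "\<eta> / d ^ h * (1 - 1 / 2 ^ (k - h)) \<le> \<eta> / d ^ h * 1"
      by (intro mult_left_mono) auto
    with step[OF that(1), of h "k - h"] that(2) show ?thesis by simp
  qed
  have ev: "\<exists>N. \<forall>j\<ge>N. \<bar>e j\<bar> \<le> \<eta>" if "\<eta> > 0" for \<eta>
    using LIMSEQ_D[OF e that] by (metis diff_zero less_imp_le real_norm_def)
  have "Cauchy y"
  proof (rule CauchyI')
    fix \<epsilon> :: real assume "\<epsilon> > 0"
    then obtain N where N: "\<And>j. j \<ge> N \<Longrightarrow> \<bar>e j\<bar> \<le> \<epsilon> / 2" using ev[of "\<epsilon> / 2"] by auto
    have "\<bar>y n - y m\<bar> \<le> \<epsilon> / 2" if "m \<ge> N" "n > m" for m n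
    proof -
      have "\<bar>y n - y m\<bar> \<le> \<epsilon> / 2 / d ^ m" using N that by (intro bound) auto
      also have "\<dots> \<le> \<epsilon> / 2 / 1" using \<open>d \<ge> 2\<close> \<open>\<epsilon> > 0\<close> by (intro frac_le) auto
      finally show ?thesis by simp
    qed
    then have "\<forall>m\<ge>N. \<forall>n>m. dist (y m) (y n) < \<epsilon>"
      using \<open>\<epsilon> > 0\<close> by (fastforce simp: dist_real_def abs_minus_commute)
    then show "\<exists>M. \<forall>m\<ge>M. \<forall>n>m. dist (y m) (y n) < \<epsilon>" by blast
  qed
  then obtain l where l: "y \<longlonglongrightarrow> l" by (auto simp: Cauchy_convergent_iff convergent_def)
  have lim: "\<bar>x h - d ^ h * l\<bar> \<le> \<eta>" if "\<And>j. j \<ge> h \<Longrightarrow> \<bar>e j\<bar> \<le> \<eta>" for h \<eta>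
  proof -
    have "(\<lambda>k. \<bar>y k - y h\<bar>) \<longlonglongrightarrow> \<bar>l - y h\<bar>" by (intro tendsto_intros l)
    then have "\<bar>l - y h\<bar> \<le> \<eta> / d ^ h"
      by (rule LIMSEQ_le_const2) (use bound[OF that] in blast)
    then have "d ^ h * \<bar>l - y h\<bar> \<le> \<eta>"
      using \<open>d \<ge> 2\<close> by (simp add: field_simps)
    also have "d ^ h * \<bar>l - y h\<bar> = \<bar>d ^ h * (l - y h)\<bar>"
      using \<open>d \<ge> 2\<close> by (simp add: abs_mult)
    also have "d ^ h * (l - y h) = d ^ h * l - x h"
      using \<open>d \<ge> 2\<close> by (simp add: y_def field_simps)
    finally show ?thesis by linarith
  qed
  have "(\<lambda>h. x h - d ^ h * l) \<longlonglongrightarrow> 0"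
  proof (rule LIMSEQ_I)
    fix \<epsilon> :: real assume "\<epsilon> > 0"
    then obtain N where N: "\<And>j. j \<ge> N \<Longrightarrow> \<bar>e j\<bar> \<le> \<epsilon> / 2" using ev[of "\<epsilon> / 2"] by auto
    have "norm (x h - d ^ h * l - 0) < \<epsilon>" if "h \<ge> N" for h
      using lim[of h "\<epsilon> / 2"] N that \<open>\<epsilon> > 0\<close> by fastforce
    then show "\<exists>N. \<forall>h\<ge>N. norm (x h - d ^ h * l - 0) < \<epsilon>" by blast
  qed
  then show ?thesis by (rule that)
qed

text \<open>Makes the subtraction in the recurrence exact and the sequence strictly increasing. The
  case \<open>d = 2\<close> comes down to \<open>a \<le> a ^ 2\<close>; Pascal's rule gives the step
  in \<open>d\<close>.\<close>

lemma choose_add_ge: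
  assumes "d \<ge> 2" "a \<ge> 1"
  shows "2 * a + 1 \<le> (d + a) choose d"
  using assms(1)
proof (induction d rule: dec_induct)
  case base
  have "(2 * a + 1) * 2 \<le> (2 + a) * (2 + a - 1)" using assms(2) by (simp add: algebra_simps)
  then have "2 * a + 1 \<le> (2 + a) * (2 + a - 1) div 2"
    by (simp add: less_eq_div_iff_mult_less_eq)
  then show ?case by (simp add: choose_two)
qed simp

text \<open>Both sides are a rising factorial starting at \<open>a + 1\<close>. The product of
  \<open>d\<close> linear factors can be compared with \<open>a ^ d\<close> factor by
  factor.\<close>

lemma fact_choose_add:
  "fact d * real ((d + a) choose d) = (\<Prod>i<d. real a + real (Suc i))"
proof -
  have "fact d * real ((d + a) choose d) = pochhammer (real a + 1) d"
    using gbinomial_pochhammer'[of "real (d + a)" d] by (simp add: binomial_gbinomial)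
  then show ?thesis by (simp add: pochhammer_prod add_ac lessThan_atLeast0)
qed

section \<open>Growth of the binomial recurrence\<close>

locale choose_recurrence =
  fixes d :: nat and a :: "nat \<Rightarrow> nat"
  assumes d: "d \<ge> 2" and init: "a 0 = 1"
    and rec: "a (Suc h) = ((d + a h) choose d) - a h"
begin

lemma pos: "a h \<ge> 1"
proof (induction h)
  case (Suc h)
  then show ?case using choose_add_ge[OF d Suc] by (simp add: rec)
qed (simp add: init)

lemma ge: "Suc h \<le> a h"
proof (induction h)
  case (Suc h)
  then show ?case using choose_add_ge[OF d pos[of h]] by (simp add: rec)
qed (simp add: init)

lemma filterlim_a: "filterlim (\<lambda>h. real (a h)) at_top sequentially"
  by (rule filterlim_at_top_mono[OF filterlim_real_sequentially])
    (use ge in \<open>auto intro!: always_eventually simp: Suc_leD\<close>)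

text \<open>The binomial coefficient contributes factors \<open>1 + Suc i / a h\<close>, each
  tending to 1, and the subtracted \<open>a h\<close> is of lower order than \<open>a h ^ d\<close>
  since \<open>d \<ge> 2\<close>.\<close>

lemma ratio_tendsto: "(\<lambda>h. fact d * real (a (Suc h)) / real (a h) ^ d) \<longlonglongrightarrow> 1"
proof -
  have inv: "(\<lambda>h. c / real (a h)) \<longlonglongrightarrow> 0" for c
    by (intro tendsto_divide_0[OF tendsto_const] filterlim_at_top_imp_at_infinity filterlim_a)
  have eq: "fact d * real (a (Suc h)) / real (a h) ^ d =
      (\<Prod>i<d. 1 + real (Suc i) / real (a h)) - fact d * (1 / real (a h)) ^ (d - 1)" for h
  proof -
    have "fact d * real (a (Suc h)) = (\<Prod>i<d. real (a h) + real (Suc i)) - fact d * real (a h)"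
      using choose_add_ge[OF d pos[of h]] by (simp add: rec of_nat_diff right_diff_distrib fact_choose_add)
    moreover have "(\<Prod>i<d. real (a h) + real (Suc i)) / real (a h) ^ d = (\<Prod>i<d. 1 + real (Suc i) / real (a h))"
    proof -
      have "(\<Prod>i<d. real (a h) + real (Suc i)) / real (a h) ^ d
          = (\<Prod>i<d. (real (a h) + real (Suc i)) / real (a h))"
        by (simp add: prod_dividef)
      also have "\<dots> = (\<Prod>i<d. 1 + real (Suc i) / real (a h))"
        using pos[of h] by (intro prod.cong) (auto simp: add_divide_distrib)
      finally show ?thesis .
    qed
    moreover have "fact d * real (a h) / real (a h) ^ d = fact d * (1 / real (a h)) ^ (d - 1)"
      using pos[of h] d by (cases d) (auto simp: power_divide)
    ultimately show ?thesis by (simp add: diff_divide_distrib)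
  qed
  have "(\<lambda>h. (\<Prod>i<d. 1 + real (Suc i) / real (a h)) - fact d * (1 / real (a h)) ^ (d - 1))
      \<longlonglongrightarrow> (\<Prod>i<d. 1 + 0) - fact d * 0 ^ (d - 1)"
    by (intro tendsto_intros inv)
  then show ?thesis unfolding eq using d by (simp add: power_0_left)
qed

lemma computable: "computable_fun a"
proof -
  have "rec_nat 1 (\<lambda>n y. ((d + y) choose d) - y) h = a h" for h
    by (induction h) (auto simp: init rec)
  moreover have "recursive_on 1 (\<lambda>xs. rec_nat 1 (\<lambda>n y. ((d + y) choose d) - y) (xs ! 0))"
    by (intro recursive_on_rec_unary recursive_on_diff recursive_on_proj
        recursive_on_unop[OF recursive_on_choose]) simp_all
  ultimately show ?thesis by (simp add: computable_fun_iff)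
qed

text \<open>The positive solution of \<open>c ^ (d - 1) = fact d\<close>: dividing the sequence by
  \<open>c\<close> absorbs the factorial in the leading behaviour \<open>a h ^ d / fact d\<close> of
  \<open>a (Suc h)\<close>.\<close>

definition c :: real where "c = (fact d) powr (1 / (real d - 1))"

lemma c: "c > 0" "c ^ d = fact d * c"
proof -
  show "c > 0" by (simp add: c_def)
  have "c ^ (d - 1) = c powr (real d - 1)"
    using \<open>c > 0\<close> d by (simp add: powr_realpow of_nat_diff flip: powr_realpow)
  also have "\<dots> = fact d" using d by (simp add: c_def powr_powr)
  finally show "c ^ d = fact d * c" using d by (cases d) auto
qed

theorem asymptotics:
  obtains \<kappa> :: real and \<epsilon> :: "nat \<Rightarrow> real" where "computable_real \<kappa>" "\<kappa> > 1"
    "\<epsilon> \<in> o(\<lambda>_. 1)" "\<And>h. real (a h) = (1 + \<epsilon> h) * c * \<kappa> ^ (d ^ h)"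
proof -
  define x where "x h = ln (real (a h) / c)" for h
  define e where "e h = ln (fact d * real (a (Suc h)) / real (a h) ^ d)" for h
  have apos: "real (a h) > 0" for h using pos[of h] by simp
  have "x (Suc h) = real d * x h + e h" for h
  proof -
    have "real d * x h + e h = ln ((real (a h) / c) ^ d) + e h"
      using apos[of h] c(1) by (simp add: x_def ln_realpow)
    also have "\<dots> = ln ((real (a h) / c) ^ d * (fact d * real (a (Suc h)) / real (a h) ^ d))"
      unfolding e_def using apos[of h] apos[of "Suc h"] c(1) by (intro ln_mult_pos[symmetric]) auto
    also have "(real (a h) / c) ^ d * (fact d * real (a (Suc h)) / real (a h) ^ d) = real (a (Suc h)) / c"
      using apos[of h] c by (simp add: power_divide field_simps)
    finally show ?thesis by (simp add: x_def)
  qed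
  moreover have "e \<longlonglongrightarrow> 0"
    using tendsto_ln[OF ratio_tendsto] by (simp add: e_def[abs_def])
  ultimately obtain l where l: "(\<lambda>h. x h - real d ^ h * l) \<longlonglongrightarrow> 0"
    using affine_recurrence_asymptotics[of "real d" x e] d by auto
  define \<kappa> where "\<kappa> = exp l"
  \<comment> \<open>With this choice the asymptotic formula is an identity, and
    \<open>\<epsilon>\<close> tends to 0 because the exponent does.\<close>
  define \<epsilon> where "\<epsilon> h = exp (x h - real d ^ h * l) - 1" for h
  have "filterlim x at_top sequentially"
    unfolding x_def divide_inverse
    by (intro filterlim_compose[OF ln_at_top] filterlim_at_top_mult_tendsto_pos[OF tendsto_const] filterlim_a)
      (use c(1) in simp)
  \<comment> \<open>Otherwise subtracting \<open>real d ^ h * l\<close> would not decrease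
    \<open>x h\<close>, which tends to infinity, although the difference tends to 0.\<close>
  have "l > 0"
  proof (rule ccontr)
    assume "\<not> l > 0"
    then have "x h \<le> x h - real d ^ h * l" for h
      by (simp add: mult_nonneg_nonpos)
    then have "filterlim (\<lambda>h. x h - real d ^ h * l) at_top sequentially"
      using \<open>filterlim x at_top sequentially\<close> by (auto intro: filterlim_at_top_mono always_eventually)
    with l show False
      using not_tendsto_and_filterlim_at_infinity filterlim_at_top_imp_at_infinity sequentially_bot by blast
  qed
  then have "\<kappa> > 1" by (simp add: \<kappa>_def)
  have eq: "real (a h) = (1 + \<epsilon> h) * c * \<kappa> ^ (d ^ h)" for h
    using apos[of h] c(1)
    by (simp add: \<epsilon>_def \<kappa>_def x_def exp_diff flip: exp_of_nat_mult)
  have "\<epsilon> \<longlonglongrightarrow> 0"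
    using tendsto_diff[OF tendsto_exp[OF l] tendsto_const[of 1]] by (simp add: \<epsilon>_def[abs_def])
  then have "\<epsilon> \<in> o(\<lambda>_. 1)" by (intro smalloI_tendsto) auto
  \<comment> \<open>A convergent sequence is bounded; adding \<open>\<bar>ln c\<bar>\<close> yields
    the uniform bound required for computing \<open>\<kappa>\<close>.\<close>
  obtain L where L: "\<And>h. \<bar>x h - real d ^ h * l\<bar> \<le> L"
    using convergent_imp_Bseq[OF convergentI[OF l]] by (auto simp: Bseq_def)
  have "computable_real \<kappa>"
  proof (rule computable_real_doubly_exponential[OF computable _ _ d])
    show "\<bar>ln (real (a h)) - real d ^ h * ln \<kappa>\<bar> \<le> L + \<bar>ln c\<bar>" for h
    proof -
      have "x h = ln (real (a h)) - ln c" using apos[of h] c(1) by (simp add: x_def ln_div)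
      then show ?thesis using L[of h] by (simp add: \<kappa>_def)
    qed
  qed (use \<open>\<kappa> > 1\<close> apos in auto)
  show ?thesis by (rule that) fact+
qed

end

theorem theorem2p3:
  fixes d :: nat
  assumes "d \<ge> 2"
  shows "num_leaf_induced (complete_tree d 0) = 1 \<and>
    (\<forall>h\<ge>1. int (num_leaf_induced (complete_tree d h)) =
       - int (num_leaf_induced (complete_tree d (h - 1)))
       + int ((d + num_leaf_induced (complete_tree d (h - 1))) choose d)) \<and>
    (\<exists>\<kappa>::real. computable_real \<kappa> \<and> \<kappa> > 1 \<and>
       (\<exists>\<epsilon> :: nat \<Rightarrow> real. \<epsilon> \<in> o(\<lambda>_. 1) \<and>
          (\<forall>h. real (num_leaf_induced (complete_tree d h)) =
             (1 + \<epsilon> h) * (fact d) powr (1 / (real d - 1)) * \<kappa> ^ (d ^ h))))"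
proof -
  define a where "a h = num_leaf_induced (complete_tree d h)" for h
  have a: "a h = card (shapes d h)" for h
    using num_leaf_induced_eq_card_shapes assms by (simp add: a_def)
  have init: "a 0 = 1" by (simp add: a)
  \<comment> \<open>The additive form yields both the recurrence with truncated subtraction and the
    integer recurrence of the theorem.\<close>
  have count_Suc: "a (Suc h) + a h = (d + a h) choose d" for h
    using card_shapes_Suc[OF assms] by (simp add: a)
  interpret choose_recurrence d a
    by unfold_locales (use assms init in \<open>auto simp flip: count_Suc\<close>)
  have "int (a h) = - int (a (h - 1)) + int ((d + a (h - 1)) choose d)" if "h \<ge> 1" for h
    using that by (cases h) (auto simp flip: count_Suc)
  moreover obtain \<kappa> :: real and \<epsilon> :: "nat \<Rightarrow> real" where "computable_real \<kappa>" "\<kappa> > 1"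
    "\<epsilon> \<in> o(\<lambda>_. 1)" "\<And>h. real (a h) = (1 + \<epsilon> h) * c * \<kappa> ^ (d ^ h)"
    using asymptotics by blast
  ultimately show ?thesis
    using init unfolding a_def c_def by blast
qed

end
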